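(* Let $k$ be a field of prime characteristic $p$ and let $G$ be a locally finite group with a normal $p$-subgroup $P$. Then $P$ acts trivially on every irreducible $kG$-module $V$.
   Context: A group is locally finite if every finitely generated subgroup of it is finite. A $p$-subgroup is a subgroup (possibly infinite) in which every element has order a power of $p$. $kG$ is the group algebra and modules are left modules, possibly infinite dimensional over $k$; a module is irreducible if it is nonzero and has no submodules other than $0$ and itself. *)

theory Defs
  imports "HOL-Algebra.Multiplicative_Group" "HOL-Computational_Algebra.Primes"
begin

section \<open>Groups\<close>

definition locally_finite :: "('g, 'm) monoid_scheme \<Rightarrow> bool" where
  "locally_finite G \<longleftrightarrow>
     group G \<and> (\<forall>S. finite S \<and> S \<subseteq> carrier G \<longrightarrow> finite (generate G S))"

text \<open>As \<^const>\<open>group.ord\<close> is \<open>0\<close> on elements of infinite order, the equation below forces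
  \<open>x\<close> to have finite order when \<open>p > 0\<close>.\<close>

definition p_subgroup :: "nat \<Rightarrow> 'g set \<Rightarrow> ('g, 'm) monoid_scheme \<Rightarrow> bool" where
  "p_subgroup p P G \<longleftrightarrow> subgroup P G \<and> (\<forall>x\<in>P. \<exists>n. group.ord G x = p ^ n)"

section \<open>Characteristic\<close>

definition ring_characteristic :: "('k, 'm) ring_scheme \<Rightarrow> nat" where
  "ring_characteristic R =
     (if \<exists>n::nat. n > 0 \<and> [n] \<cdot>\<^bsub>R\<^esub> \<one>\<^bsub>R\<^esub> = \<zero>\<^bsub>R\<^esub>
      then LEAST n::nat. n > 0 \<and> [n] \<cdot>\<^bsub>R\<^esub> \<one>\<^bsub>R\<^esub> = \<zero>\<^bsub>R\<^esub>
      else 0)"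

section \<open>The group algebra\<close>

definition coeff_support ::
    "('k, 'n) ring_scheme \<Rightarrow> ('g, 'm) monoid_scheme \<Rightarrow> ('g \<Rightarrow> 'k) \<Rightarrow> 'g set" where
  "coeff_support K G a = {x \<in> carrier G. a x \<noteq> \<zero>\<^bsub>K\<^esub>}"

text \<open>The formal sum \<open>\<Sum>x. a\<^sub>x x\<close> is represented by its coefficient function, which is finitely
  supported on \<open>carrier G\<close> and takes the value \<open>\<zero>\<close> outside \<open>carrier G\<close>. The product is
  convolution, \<open>(a b)(g) = \<Sum>x. a(x) b(x\<^sup>-\<^sup>1 g)\<close>.\<close>

definition group_algebra ::
    "('k, 'n) ring_scheme \<Rightarrow> ('g, 'm) monoid_scheme \<Rightarrow> ('g \<Rightarrow> 'k) ring" where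
  "group_algebra K G =
     \<lparr> carrier = {a. (\<forall>g \<in> carrier G. a g \<in> carrier K) \<and>
                     (\<forall>g. g \<notin> carrier G \<longrightarrow> a g = \<zero>\<^bsub>K\<^esub>) \<and>
                     finite (coeff_support K G a)},
       monoid.mult = (\<lambda>a b g.
         if g \<in> carrier G
         then \<Oplus>\<^bsub>K\<^esub>x \<in> coeff_support K G a. a x \<otimes>\<^bsub>K\<^esub> b (inv\<^bsub>G\<^esub> x \<otimes>\<^bsub>G\<^esub> g)
         else \<zero>\<^bsub>K\<^esub>),
       one = (\<lambda>g. if g = \<one>\<^bsub>G\<^esub> then \<one>\<^bsub>K\<^esub> else \<zero>\<^bsub>K\<^esub>),
       zero = (\<lambda>g. \<zero>\<^bsub>K\<^esub>),
       add = (\<lambda>a b g. a g \<oplus>\<^bsub>K\<^esub> b g) \<rparr>"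

definition group_algebra_basis :: "('k, 'n) ring_scheme \<Rightarrow> 'g \<Rightarrow> 'g \<Rightarrow> 'k" where
  "group_algebra_basis K x = (\<lambda>g. if g = x then \<one>\<^bsub>K\<^esub> else \<zero>\<^bsub>K\<^esub>)"

context
  fixes K (structure) and G (structure) and A
  assumes ring_K: "ring K" and group_G: "group G"
  defines "A \<equiv> group_algebra K G"
begin

interpretation K: ring K by (rule ring_K)
interpretation G: group G by (rule group_G)

private lemma in_A_iff:
  "a \<in> carrier A \<longleftrightarrow> (\<forall>g. a g \<in> carrier K) \<and> (\<forall>g. g \<notin> carrier G \<longrightarrow> a g = \<zero>) \<and>
     finite (coeff_support K G a)"
  unfolding A_def group_algebra_def by auto

private lemma A_coeff: "a \<in> carrier A \<Longrightarrow> a g \<in> carrier K"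
  by (simp add: in_A_iff)

private lemma A_I:
  assumes "\<And>g. a g \<in> carrier K" "finite S" "S \<subseteq> carrier G" "\<And>g. g \<notin> S \<Longrightarrow> a g = \<zero>"
  shows "a \<in> carrier A"
proof -
  have "coeff_support K G a \<subseteq> S"
    using assms(4) by (auto simp: coeff_support_def)
  then show ?thesis
    using assms by (auto simp: in_A_iff intro: finite_subset)
qed

private lemma A_mult_superset:
  assumes a: "a \<in> carrier A" and b: "b \<in> carrier A"
    and S: "finite S" "coeff_support K G a \<subseteq> S" "S \<subseteq> carrier G" and g: "g \<in> carrier G"
  shows "(a \<otimes>\<^bsub>A\<^esub> b) g = (\<Oplus>x \<in> S. a x \<otimes> b (inv\<^bsub>G\<^esub> x \<otimes>\<^bsub>G\<^esub> g))"
proof -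
  have "(\<Oplus>x \<in> coeff_support K G a. a x \<otimes> b (inv\<^bsub>G\<^esub> x \<otimes>\<^bsub>G\<^esub> g)) =
        (\<Oplus>x \<in> S. a x \<otimes> b (inv\<^bsub>G\<^esub> x \<otimes>\<^bsub>G\<^esub> g))"
    by (rule K.add.finprod_mono_neutral_cong_left)
       (use S a b in \<open>auto simp: A_coeff coeff_support_def\<close>)
  then show ?thesis
    using g by (simp add: A_def group_algebra_def)
qed

private lemma A_mult_outside: "g \<notin> carrier G \<Longrightarrow> (a \<otimes>\<^bsub>A\<^esub> b) g = \<zero>"
  by (simp add: A_def group_algebra_def)

private lemma A_supp:
  assumes "a \<in> carrier A"
  shows "finite (coeff_support K G a)" "coeff_support K G a \<subseteq> carrier G"
    "\<And>x. x \<notin> coeff_support K G a \<Longrightarrow> a x = \<zero>"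
  using assms by (auto simp: in_A_iff coeff_support_def)

private lemma A_mult_nonzero:
  assumes a: "a \<in> carrier A" and b: "b \<in> carrier A" and nz: "(a \<otimes>\<^bsub>A\<^esub> b) g \<noteq> \<zero>"
  shows "g \<in> (\<lambda>(x, y). x \<otimes>\<^bsub>G\<^esub> y) ` (coeff_support K G a \<times> coeff_support K G b)"
proof (rule ccontr)
  assume n: "\<not> ?thesis"
  have g: "g \<in> carrier G"
    using nz A_mult_outside by blast
  have "(a \<otimes>\<^bsub>A\<^esub> b) g = (\<Oplus>x \<in> coeff_support K G a. a x \<otimes> b (inv\<^bsub>G\<^esub> x \<otimes>\<^bsub>G\<^esub> g))"
    using A_mult_superset[OF a b _ _ _ g] A_supp[OF a] by blast
  also have "\<dots> = (\<Oplus>x \<in> coeff_support K G a. \<zero>)"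
  proof (rule K.finsum_cong'[OF refl])
    fix x assume x: "x \<in> coeff_support K G a"
    then have xG: "x \<in> carrier G"
      by (auto simp: coeff_support_def)
    have "x \<otimes>\<^bsub>G\<^esub> (inv\<^bsub>G\<^esub> x \<otimes>\<^bsub>G\<^esub> g) = g"
      using xG g by (simp add: G.m_assoc[symmetric])
    then have "inv\<^bsub>G\<^esub> x \<otimes>\<^bsub>G\<^esub> g \<notin> coeff_support K G b"
      using n x by force
    then show "a x \<otimes> b (inv\<^bsub>G\<^esub> x \<otimes>\<^bsub>G\<^esub> g) = \<zero>"
      using A_supp(3)[OF b] A_coeff[OF a] by simp
  qed auto
  finally show False
    using nz by simp
qed

private lemma A_mult_closed:
  assumes a: "a \<in> carrier A" and b: "b \<in> carrier A"
  shows "a \<otimes>\<^bsub>A\<^esub> b \<in> carrier A"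
proof (rule A_I)
  let ?S = "(\<lambda>(x, y). x \<otimes>\<^bsub>G\<^esub> y) ` (coeff_support K G a \<times> coeff_support K G b)"
  show "finite ?S" "?S \<subseteq> carrier G"
    using A_supp[OF a] A_supp[OF b] by auto
  show "(a \<otimes>\<^bsub>A\<^esub> b) g = \<zero>" if "g \<notin> ?S" for g
    using A_mult_nonzero[OF a b] that by blast
  show "(a \<otimes>\<^bsub>A\<^esub> b) g \<in> carrier K" for g
  proof (cases "g \<in> carrier G")
    case True
    show ?thesis
      unfolding A_mult_superset[OF a b A_supp(1)[OF a] order_refl A_supp(2)[OF a] True]
      using A_coeff[OF a] A_coeff[OF b] by (auto intro!: K.finsum_closed)
  qed (simp add: A_mult_outside)
qed

private lemma finsum_swap:
  assumes "finite X" "finite Y" "\<And>x y. x \<in> X \<Longrightarrow> y \<in> Y \<Longrightarrow> f x y \<in> carrier K"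
  shows "(\<Oplus>x\<in>X. \<Oplus>y\<in>Y. f x y) = (\<Oplus>y\<in>Y. \<Oplus>x\<in>X. f x y)"
  using assms(1,3)
proof (induction X)
  case empty
  then show ?case
    by simp
next
  case (insert x X)
  have "(\<Oplus>y\<in>Y. \<Oplus>x\<in>insert x X. f x y) = (\<Oplus>y\<in>Y. f x y \<oplus> (\<Oplus>x\<in>X. f x y))"
    by (rule K.finsum_cong'[OF refl])
       (use insert in \<open>auto intro!: K.finsum_closed K.a_closed\<close>)
  also have "\<dots> = (\<Oplus>y\<in>Y. f x y) \<oplus> (\<Oplus>y\<in>Y. \<Oplus>x\<in>X. f x y)"
    by (rule K.finsum_addf) (use insert in \<open>auto intro!: K.finsum_closed\<close>)
  also have "\<dots> = (\<Oplus>x\<in>insert x X. \<Oplus>y\<in>Y. f x y)"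
    using insert by (subst K.finsum_insert) (auto intro!: K.finsum_closed)
  finally show ?case ..
qed

private lemma A_assoc:
  assumes a: "a \<in> carrier A" and b: "b \<in> carrier A" and c: "c \<in> carrier A"
  shows "(a \<otimes>\<^bsub>A\<^esub> b) \<otimes>\<^bsub>A\<^esub> c = a \<otimes>\<^bsub>A\<^esub> (b \<otimes>\<^bsub>A\<^esub> c)"
proof
  fix g
  show "((a \<otimes>\<^bsub>A\<^esub> b) \<otimes>\<^bsub>A\<^esub> c) g = (a \<otimes>\<^bsub>A\<^esub> (b \<otimes>\<^bsub>A\<^esub> c)) g"
  proof (cases "g \<in> carrier G")
    case False
    then show ?thesis
      by (simp add: A_mult_outside)
  next
    case g: True
    let ?X = "coeff_support K G a" and ?Y = "coeff_support K G b"
    let ?U = "(\<lambda>(x, y). x \<otimes>\<^bsub>G\<^esub> y) ` (?X \<times> ?Y)"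
    note Xs = A_supp[OF a] and Ys = A_supp[OF b]
    note ac = A_coeff[OF a] and bc = A_coeff[OF b] and cc = A_coeff[OF c]
    have U: "finite ?U" "?U \<subseteq> carrier G"
      using Xs Ys by auto
    have sU: "coeff_support K G (a \<otimes>\<^bsub>A\<^esub> b) \<subseteq> ?U"
      using A_mult_nonzero[OF a b] unfolding coeff_support_def[of K G "a \<otimes>\<^bsub>A\<^esub> b"] by blast
    have inner: "(\<Oplus>u\<in>?U. b (inv\<^bsub>G\<^esub> x \<otimes>\<^bsub>G\<^esub> u) \<otimes> c (inv\<^bsub>G\<^esub> u \<otimes>\<^bsub>G\<^esub> g)) =
        (b \<otimes>\<^bsub>A\<^esub> c) (inv\<^bsub>G\<^esub> x \<otimes>\<^bsub>G\<^esub> g)" if x: "x \<in> ?X" for x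
    proof -
      have xG: "x \<in> carrier G"
        using x Xs by auto
      let ?h = "\<lambda>u. inv\<^bsub>G\<^esub> x \<otimes>\<^bsub>G\<^esub> u"
      have inj: "inj_on ?h ?U"
        using U(2) xG by (intro inj_onI) (metis G.inv_closed G.Units_eq G.Units_l_cancel subsetD)
      have sub: "?Y \<subseteq> ?h ` ?U"
      proof
        fix y assume y: "y \<in> ?Y"
        then have "y = ?h (x \<otimes>\<^bsub>G\<^esub> y)"
          using xG Ys(2) by (simp add: G.m_assoc[symmetric] subset_iff)
        moreover have "x \<otimes>\<^bsub>G\<^esub> y \<in> ?U"
          using x y by auto
        ultimately show "y \<in> ?h ` ?U"
          by blast
      qed
      have "(b \<otimes>\<^bsub>A\<^esub> c) (?h g) = (\<Oplus>y\<in>?h ` ?U. b y \<otimes> c (inv\<^bsub>G\<^esub> y \<otimes>\<^bsub>G\<^esub> ?h g))"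
        by (rule A_mult_superset[OF b c _ sub]) (use U xG g in auto)
      also have "\<dots> = (\<Oplus>u\<in>?U. b (?h u) \<otimes> c (inv\<^bsub>G\<^esub> (?h u) \<otimes>\<^bsub>G\<^esub> ?h g))"
        by (rule K.finsum_reindex) (use inj bc cc in auto)
      also have "\<dots> = (\<Oplus>u\<in>?U. b (?h u) \<otimes> c (inv\<^bsub>G\<^esub> u \<otimes>\<^bsub>G\<^esub> g))"
      proof (rule K.finsum_cong'[OF refl])
        fix u assume "u \<in> ?U"
        then have uG: "u \<in> carrier G"
          using U(2) by blast
        have "inv\<^bsub>G\<^esub> (?h u) \<otimes>\<^bsub>G\<^esub> ?h g = inv\<^bsub>G\<^esub> u \<otimes>\<^bsub>G\<^esub> (x \<otimes>\<^bsub>G\<^esub> (inv\<^bsub>G\<^esub> x \<otimes>\<^bsub>G\<^esub> g))"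
          using uG xG g by (simp add: G.inv_mult_group G.m_assoc)
        also have "\<dots> = inv\<^bsub>G\<^esub> u \<otimes>\<^bsub>G\<^esub> g"
          using xG g by (simp add: G.m_assoc[symmetric])
        finally show "b (?h u) \<otimes> c (inv\<^bsub>G\<^esub> (?h u) \<otimes>\<^bsub>G\<^esub> ?h g) =
            b (?h u) \<otimes> c (inv\<^bsub>G\<^esub> u \<otimes>\<^bsub>G\<^esub> g)"
          by simp
      qed (use bc cc in auto)
      finally show ?thesis ..
    qed
    have "((a \<otimes>\<^bsub>A\<^esub> b) \<otimes>\<^bsub>A\<^esub> c) g =
        (\<Oplus>u\<in>?U. (a \<otimes>\<^bsub>A\<^esub> b) u \<otimes> c (inv\<^bsub>G\<^esub> u \<otimes>\<^bsub>G\<^esub> g))"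
      by (rule A_mult_superset[OF A_mult_closed[OF a b] c U(1) sU U(2) g])
    also have "\<dots> = (\<Oplus>u\<in>?U. \<Oplus>x\<in>?X. a x \<otimes> (b (inv\<^bsub>G\<^esub> x \<otimes>\<^bsub>G\<^esub> u) \<otimes> c (inv\<^bsub>G\<^esub> u \<otimes>\<^bsub>G\<^esub> g)))"
    proof (rule K.finsum_cong'[OF refl])
      fix u assume "u \<in> ?U"
      then have uG: "u \<in> carrier G"
        using U(2) by blast
      have "(a \<otimes>\<^bsub>A\<^esub> b) u = (\<Oplus>x\<in>?X. a x \<otimes> b (inv\<^bsub>G\<^esub> x \<otimes>\<^bsub>G\<^esub> u))"
        by (rule A_mult_superset[OF a b Xs(1) order_refl Xs(2) uG])
      then show "(a \<otimes>\<^bsub>A\<^esub> b) u \<otimes> c (inv\<^bsub>G\<^esub> u \<otimes>\<^bsub>G\<^esub> g) =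
          (\<Oplus>x\<in>?X. a x \<otimes> (b (inv\<^bsub>G\<^esub> x \<otimes>\<^bsub>G\<^esub> u) \<otimes> c (inv\<^bsub>G\<^esub> u \<otimes>\<^bsub>G\<^esub> g)))"
        using ac bc cc by (simp add: K.finsum_ldistr[OF Xs(1)] K.m_assoc)
    qed (use ac bc cc in \<open>auto intro!: K.finsum_closed\<close>)
    also have "\<dots> = (\<Oplus>x\<in>?X. \<Oplus>u\<in>?U. a x \<otimes> (b (inv\<^bsub>G\<^esub> x \<otimes>\<^bsub>G\<^esub> u) \<otimes> c (inv\<^bsub>G\<^esub> u \<otimes>\<^bsub>G\<^esub> g)))"
      by (rule finsum_swap) (use U Xs ac bc cc in auto)
    also have "\<dots> = (\<Oplus>x\<in>?X. a x \<otimes> (b \<otimes>\<^bsub>A\<^esub> c) (inv\<^bsub>G\<^esub> x \<otimes>\<^bsub>G\<^esub> g))"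
    proof (rule K.finsum_cong'[OF refl])
      fix x assume x: "x \<in> ?X"
      have "(\<Oplus>u\<in>?U. a x \<otimes> (b (inv\<^bsub>G\<^esub> x \<otimes>\<^bsub>G\<^esub> u) \<otimes> c (inv\<^bsub>G\<^esub> u \<otimes>\<^bsub>G\<^esub> g))) =
          a x \<otimes> (\<Oplus>u\<in>?U. b (inv\<^bsub>G\<^esub> x \<otimes>\<^bsub>G\<^esub> u) \<otimes> c (inv\<^bsub>G\<^esub> u \<otimes>\<^bsub>G\<^esub> g))"
        by (rule K.finsum_rdistr[symmetric]) (use U ac bc cc in auto)
      then show "(\<Oplus>u\<in>?U. a x \<otimes> (b (inv\<^bsub>G\<^esub> x \<otimes>\<^bsub>G\<^esub> u) \<otimes> c (inv\<^bsub>G\<^esub> u \<otimes>\<^bsub>G\<^esub> g))) =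
          a x \<otimes> (b \<otimes>\<^bsub>A\<^esub> c) (inv\<^bsub>G\<^esub> x \<otimes>\<^bsub>G\<^esub> g)"
        using inner[OF x] by simp
    qed (use ac A_coeff[OF A_mult_closed[OF b c]] in auto)
    also have "\<dots> = (a \<otimes>\<^bsub>A\<^esub> (b \<otimes>\<^bsub>A\<^esub> c)) g"
      by (rule A_mult_superset[OF a A_mult_closed[OF b c] Xs(1) order_refl Xs(2) g, symmetric])
    finally show ?thesis .
  qed
qed

private lemma A_add: "(a \<oplus>\<^bsub>A\<^esub> b) = (\<lambda>g. a g \<oplus> b g)"
  and A_zero: "\<zero>\<^bsub>A\<^esub> = (\<lambda>g. \<zero>)"
  and A_one: "\<one>\<^bsub>A\<^esub> = (\<lambda>g. if g = \<one>\<^bsub>G\<^esub> then \<one> else \<zero>)"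
  by (simp_all add: A_def group_algebra_def)

private lemma A_add_closed:
  assumes a: "a \<in> carrier A" and b: "b \<in> carrier A"
  shows "a \<oplus>\<^bsub>A\<^esub> b \<in> carrier A"
  by (rule A_I[where S = "coeff_support K G a \<union> coeff_support K G b"])
     (use A_supp[OF a] A_supp[OF b] A_coeff[OF a] A_coeff[OF b] in \<open>auto simp: A_add\<close>)

private lemma A_one_closed: "\<one>\<^bsub>A\<^esub> \<in> carrier A"
  by (rule A_I[where S = "{\<one>\<^bsub>G\<^esub>}"]) (auto simp: A_one)

private lemma A_l_one:
  assumes a: "a \<in> carrier A"
  shows "\<one>\<^bsub>A\<^esub> \<otimes>\<^bsub>A\<^esub> a = a"
proof
  fix g
  show "(\<one>\<^bsub>A\<^esub> \<otimes>\<^bsub>A\<^esub> a) g = a g"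
  proof (cases "g \<in> carrier G")
    case True
    have "(\<one>\<^bsub>A\<^esub> \<otimes>\<^bsub>A\<^esub> a) g = (\<Oplus>x\<in>{\<one>\<^bsub>G\<^esub>}. \<one>\<^bsub>A\<^esub> x \<otimes> a (inv\<^bsub>G\<^esub> x \<otimes>\<^bsub>G\<^esub> g))"
      by (rule A_mult_superset[OF A_one_closed a _ _ _ True])
         (auto simp: A_one coeff_support_def split: if_splits)
    also have "\<dots> = a g"
      using A_coeff[OF a] True by (subst K.finsum_insert) (auto simp: A_one)
    finally show ?thesis .
  qed (use a in \<open>auto simp: A_mult_outside in_A_iff\<close>)
qed

private lemma A_r_one:
  assumes a: "a \<in> carrier A"
  shows "a \<otimes>\<^bsub>A\<^esub> \<one>\<^bsub>A\<^esub> = a"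
proof
  fix g
  show "(a \<otimes>\<^bsub>A\<^esub> \<one>\<^bsub>A\<^esub>) g = a g"
  proof (cases "g \<in> carrier G")
    case True
    let ?S = "insert g (coeff_support K G a)"
    have "(a \<otimes>\<^bsub>A\<^esub> \<one>\<^bsub>A\<^esub>) g = (\<Oplus>x\<in>?S. a x \<otimes> \<one>\<^bsub>A\<^esub> (inv\<^bsub>G\<^esub> x \<otimes>\<^bsub>G\<^esub> g))"
      by (rule A_mult_superset[OF a A_one_closed _ _ _ True]) (use A_supp[OF a] True in auto)
    also have "\<dots> = (\<Oplus>x\<in>{g}. a x \<otimes> \<one>\<^bsub>A\<^esub> (inv\<^bsub>G\<^esub> x \<otimes>\<^bsub>G\<^esub> g))"
    proof (rule K.add.finprod_mono_neutral_cong_right)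
      show "a x \<otimes> \<one>\<^bsub>A\<^esub> (inv\<^bsub>G\<^esub> x \<otimes>\<^bsub>G\<^esub> g) = \<zero>" if x: "x \<in> ?S - {g}" for x
      proof -
        from x have "x \<in> carrier G"
          using A_supp[OF a] by auto
        then have "inv\<^bsub>G\<^esub> x \<otimes>\<^bsub>G\<^esub> g \<noteq> \<one>\<^bsub>G\<^esub>"
          using x True by (metis DiffD2 G.inv_closed G.inv_equality G.inv_inv singletonI)
        then show ?thesis
          using A_coeff[OF a] by (simp add: A_one)
      qed
    qed (use A_supp[OF a] A_coeff[OF a] A_coeff[OF A_one_closed] in auto)
    also have "\<dots> = a g"
      using A_coeff[OF a] True by (subst K.finsum_insert) (auto simp: A_one)
    finally show ?thesis .
  qed (use a in \<open>auto simp: A_mult_outside in_A_iff\<close>)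
qed

private lemma A_l_distr:
  assumes a: "a \<in> carrier A" and b: "b \<in> carrier A" and c: "c \<in> carrier A"
  shows "(a \<oplus>\<^bsub>A\<^esub> b) \<otimes>\<^bsub>A\<^esub> c = (a \<otimes>\<^bsub>A\<^esub> c) \<oplus>\<^bsub>A\<^esub> (b \<otimes>\<^bsub>A\<^esub> c)"
proof
  fix g
  note cl = A_coeff[OF a] A_coeff[OF b] A_coeff[OF c]
  let ?S = "coeff_support K G a \<union> coeff_support K G b"
  have S: "finite ?S" "?S \<subseteq> carrier G"
    using A_supp[OF a] A_supp[OF b] by auto
  have sub: "coeff_support K G (a \<oplus>\<^bsub>A\<^esub> b) \<subseteq> ?S"
    by (auto simp: coeff_support_def A_add)
  show "((a \<oplus>\<^bsub>A\<^esub> b) \<otimes>\<^bsub>A\<^esub> c) g = ((a \<otimes>\<^bsub>A\<^esub> c) \<oplus>\<^bsub>A\<^esub> (b \<otimes>\<^bsub>A\<^esub> c)) g"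
  proof (cases "g \<in> carrier G")
    case True
    have "((a \<oplus>\<^bsub>A\<^esub> b) \<otimes>\<^bsub>A\<^esub> c) g =
        (\<Oplus>x\<in>?S. (a \<oplus>\<^bsub>A\<^esub> b) x \<otimes> c (inv\<^bsub>G\<^esub> x \<otimes>\<^bsub>G\<^esub> g))"
      by (rule A_mult_superset[OF A_add_closed[OF a b] c S(1) sub S(2) True])
    also have "\<dots> = (\<Oplus>x\<in>?S. a x \<otimes> c (inv\<^bsub>G\<^esub> x \<otimes>\<^bsub>G\<^esub> g) \<oplus> b x \<otimes> c (inv\<^bsub>G\<^esub> x \<otimes>\<^bsub>G\<^esub> g))"
      by (rule K.finsum_cong'[OF refl]) (use cl in \<open>auto simp: A_add K.l_distr\<close>)
    also have "\<dots> = (\<Oplus>x\<in>?S. a x \<otimes> c (inv\<^bsub>G\<^esub> x \<otimes>\<^bsub>G\<^esub> g)) \<oplus>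
        (\<Oplus>x\<in>?S. b x \<otimes> c (inv\<^bsub>G\<^esub> x \<otimes>\<^bsub>G\<^esub> g))"
      by (rule K.finsum_addf) (use cl in auto)
    also have "\<dots> = (a \<otimes>\<^bsub>A\<^esub> c) g \<oplus> (b \<otimes>\<^bsub>A\<^esub> c) g"
      using A_mult_superset[OF a c S(1) _ S(2) True] A_mult_superset[OF b c S(1) _ S(2) True]
      by simp
    finally show ?thesis
      by (simp add: A_add)
  qed (simp add: A_mult_outside A_add)
qed

private lemma A_r_distr:
  assumes a: "a \<in> carrier A" and b: "b \<in> carrier A" and c: "c \<in> carrier A"
  shows "c \<otimes>\<^bsub>A\<^esub> (a \<oplus>\<^bsub>A\<^esub> b) = (c \<otimes>\<^bsub>A\<^esub> a) \<oplus>\<^bsub>A\<^esub> (c \<otimes>\<^bsub>A\<^esub> b)"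
proof
  fix g
  note cl = A_coeff[OF a] A_coeff[OF b] A_coeff[OF c]
  note S = A_supp[OF c]
  let ?S = "coeff_support K G c"
  show "(c \<otimes>\<^bsub>A\<^esub> (a \<oplus>\<^bsub>A\<^esub> b)) g = ((c \<otimes>\<^bsub>A\<^esub> a) \<oplus>\<^bsub>A\<^esub> (c \<otimes>\<^bsub>A\<^esub> b)) g"
  proof (cases "g \<in> carrier G")
    case True
    note m = A_mult_superset[OF c _ S(1) order_refl S(2) True]
    have "(c \<otimes>\<^bsub>A\<^esub> (a \<oplus>\<^bsub>A\<^esub> b)) g =
        (\<Oplus>x\<in>?S. c x \<otimes> a (inv\<^bsub>G\<^esub> x \<otimes>\<^bsub>G\<^esub> g) \<oplus> c x \<otimes> b (inv\<^bsub>G\<^esub> x \<otimes>\<^bsub>G\<^esub> g))"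
      unfolding m[OF A_add_closed[OF a b]]
      by (rule K.finsum_cong'[OF refl]) (use cl in \<open>auto simp: A_add K.r_distr\<close>)
    also have "\<dots> = (c \<otimes>\<^bsub>A\<^esub> a) g \<oplus> (c \<otimes>\<^bsub>A\<^esub> b) g"
      unfolding m[OF a] m[OF b] by (rule K.finsum_addf) (use cl in auto)
    finally show ?thesis
      by (simp add: A_add)
  qed (simp add: A_mult_outside A_add)
qed

lemma ring_group_algebra: "ring (group_algebra K G)"
proof -
  have "ring A"
  proof (rule ringI)
    show "abelian_group A"
    proof (rule abelian_groupI)
      show "\<zero>\<^bsub>A\<^esub> \<in> carrier A"
        by (rule A_I[where S = "{}"]) (auto simp: A_zero)
      show "\<exists>y\<in>carrier A. y \<oplus>\<^bsub>A\<^esub> a = \<zero>\<^bsub>A\<^esub>" if a: "a \<in> carrier A" for a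
      proof
        show "(\<lambda>g. \<ominus> a g) \<in> carrier A"
          by (rule A_I[where S = "coeff_support K G a"]) (use A_supp[OF a] A_coeff[OF a] in auto)
        show "(\<lambda>g. \<ominus> a g) \<oplus>\<^bsub>A\<^esub> a = \<zero>\<^bsub>A\<^esub>"
          using A_coeff[OF a] by (simp add: A_add A_zero K.l_neg)
      qed
    qed (use A_add_closed in \<open>auto simp: A_add A_zero A_coeff K.a_ac\<close>)
    show "monoid A"
      by (rule monoidI) (simp_all add: A_mult_closed A_one_closed A_assoc A_l_one A_r_one)
  qed (simp_all add: A_l_distr A_r_distr)
  then show ?thesis
    by (simp add: A_def)
qed

lemma group_algebra_basis_closed:
  assumes "x \<in> carrier G"
  shows "group_algebra_basis K x \<in> carrier (group_algebra K G)"
  unfolding A_def[symmetric]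
  by (rule A_I[where S = "{x}"]) (use assms in \<open>auto simp: group_algebra_basis_def\<close>)

end

section \<open>Modules\<close>

text \<open>The axioms are those of the locale \<^locale>\<open>module\<close>, which cannot be used here because it
  requires a commutative ring of scalars. The locale \<^locale>\<open>submodule\<close> makes no such
  requirement.\<close>

locale left_module = R?: ring R + M?: abelian_group M
  for R :: "('r, 'n) ring_scheme" (structure) and M :: "('r, 'v, 'm) module_scheme" (structure) +
  assumes smult_closed:
      "\<lbrakk>a \<in> carrier R; v \<in> carrier M\<rbrakk> \<Longrightarrow> a \<odot>\<^bsub>M\<^esub> v \<in> carrier M"
    and smult_l_distr:
      "\<lbrakk>a \<in> carrier R; b \<in> carrier R; v \<in> carrier M\<rbrakk> \<Longrightarrow>
         (a \<oplus> b) \<odot>\<^bsub>M\<^esub> v = a \<odot>\<^bsub>M\<^esub> v \<oplus>\<^bsub>M\<^esub> b \<odot>\<^bsub>M\<^esub> v"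
    and smult_r_distr:
      "\<lbrakk>a \<in> carrier R; v \<in> carrier M; w \<in> carrier M\<rbrakk> \<Longrightarrow>
         a \<odot>\<^bsub>M\<^esub> (v \<oplus>\<^bsub>M\<^esub> w) = a \<odot>\<^bsub>M\<^esub> v \<oplus>\<^bsub>M\<^esub> a \<odot>\<^bsub>M\<^esub> w"
    and smult_assoc1:
      "\<lbrakk>a \<in> carrier R; b \<in> carrier R; v \<in> carrier M\<rbrakk> \<Longrightarrow>
         (a \<otimes> b) \<odot>\<^bsub>M\<^esub> v = a \<odot>\<^bsub>M\<^esub> (b \<odot>\<^bsub>M\<^esub> v)"
    and smult_one: "v \<in> carrier M \<Longrightarrow> \<one> \<odot>\<^bsub>M\<^esub> v = v"

locale irreducible_module = left_module +
  assumes nonzero: "carrier M \<noteq> {\<zero>\<^bsub>M\<^esub>}"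
    and submodule_cases: "submodule H R M \<Longrightarrow> H = {\<zero>\<^bsub>M\<^esub>} \<or> H = carrier M"

definition acts_trivially ::
    "('k, 'n) ring_scheme \<Rightarrow> 'g set \<Rightarrow> ('g \<Rightarrow> 'k, 'v, 'm) module_scheme \<Rightarrow> bool" where
  "acts_trivially K P V \<longleftrightarrow>
     (\<forall>x\<in>P. \<forall>v\<in>carrier V. group_algebra_basis K x \<odot>\<^bsub>V\<^esub> v = v)"

end

theory Submission
  imports Defs "HOL-Algebra.Group_Action" "HOL-Algebra.Left_Coset" "HOL-Algebra.Sylow"
begin

text \<open>
  Suppose that some \<open>x \<in> P\<close> moves a vector \<open>v\<close>. Then \<open>w = x v - v\<close> is nonzero, so it generates the
  irreducible module \<open>V\<close>, and \<open>v = a w = a (x - 1) v\<close> for some \<open>a\<close> in the group algebra. This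
  equation involves only \<open>x\<close> and the finitely many group elements in the support of \<open>a\<close>. They
  generate a subgroup \<open>H\<close>, which is finite because \<open>G\<close> is locally finite, and \<open>Q = P \<inter> H\<close> is a finite
  \<open>p\<close>-group that \<open>H\<close> normalizes. It remains to refute \<open>v = a (x - 1) v\<close> with \<open>v \<noteq> 0\<close>, for \<open>x \<in> Q\<close> and
  \<open>a \<in> kH\<close>; this is lemma \<open>augmentation_nakayama\<close>. The usual reason is that the two-sided ideal of
  \<open>kH\<close> generated by the elements \<open>q - 1\<close> with \<open>q \<in> Q\<close> is nilpotent. The proof below reaches the same
  contradiction without forming that ideal.

  Zorn's lemma gives a \<open>kH\<close>-submodule \<open>N\<close> of \<open>V\<close> that is maximal among those not containing \<open>v\<close>.
  Let \<open>F\<close> be the set of all vectors that \<open>Q\<close> fixes modulo \<open>N\<close>. As \<open>H\<close> normalizes \<open>Q\<close>, this is again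
  a \<open>kH\<close>-submodule (\<open>stable_fixed_mod\<close>), and it contains \<open>N\<close>. As \<open>Q\<close> is a finite \<open>p\<close>-group and
  \<open>p V = 0\<close>, it is strictly larger than \<open>N\<close> (\<open>p_group_fixes_vector_mod\<close>). By maximality \<open>v \<in> F\<close>, that
  is, \<open>(x - 1) v \<in> N\<close>, and hence \<open>v = a (x - 1) v \<in> N\<close>, a contradiction.

  The strict inclusion is the classical fact that a finite \<open>p\<close>-group has a nonzero fixed vector in
  every nonzero module of characteristic \<open>p\<close>, here the module \<open>V / N\<close>. Among the vectors outside \<open>N\<close>
  choose \<open>u\<close> with the largest stabilizer \<open>S\<close> modulo \<open>N\<close>. If \<open>S\<close> is not all of \<open>Q\<close>, then some
  \<open>q \<in> Q - S\<close> normalizes \<open>S\<close> (\<open>p_group_normalizer_grows\<close>), so \<open>S\<close> still fixes every \<open>(q - 1)^j u\<close>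
  modulo \<open>N\<close>. The operator \<open>q - 1\<close> is nilpotent (\<open>unipotent_if_prime_power_order\<close>), so the last of
  these vectors outside \<open>N\<close> is fixed modulo \<open>N\<close> by \<open>S\<close> and by \<open>q\<close>, which contradicts the choice of
  \<open>u\<close>. Working modulo \<open>N\<close> inside \<open>V\<close> avoids quotient modules throughout.
\<close>

section \<open>Finite p-groups\<close>

text \<open>The library's actions are homomorphisms into the group of extensional bijections of the set;
  hence the restriction to \<open>E\<close>.\<close>

lemma group_actionI:
  assumes "group G"
    and closed: "\<And>g x. g \<in> carrier G \<Longrightarrow> x \<in> E \<Longrightarrow> f g x \<in> E"
    and one: "\<And>x. x \<in> E \<Longrightarrow> f \<one>\<^bsub>G\<^esub> x = x"
    and mult: "\<And>g h x. g \<in> carrier G \<Longrightarrow> h \<in> carrier G \<Longrightarrow> x \<in> E \<Longrightarrow> f (g \<otimes>\<^bsub>G\<^esub> h) x = f g (f h x)"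
  shows "group_action G E (\<lambda>g. restrict (f g) E)"
proof -
  interpret group G by fact
  have bij: "restrict (f g) E \<in> Bij E" if g: "g \<in> carrier G" for g
  proof -
    have "bij_betw (restrict (f g) E) E E"
      by (rule bij_betw_byWitness[where f' = "f (inv\<^bsub>G\<^esub> g)"])
        (use g in \<open>auto simp: closed one simp flip: mult\<close>)
    then show ?thesis
      by (simp add: Bij_def)
  qed
  have "(\<lambda>g. restrict (f g) E) \<in> hom G (BijGroup E)"
    by (rule homI) (auto simp: BijGroup_def bij compose_def closed mult fun_eq_iff)
  then show ?thesis
    unfolding group_action_def
    by (intro group_hom.intro group_BijGroup \<open>group G\<close> group_hom_axioms.intro)
qed

text \<open>Orbits of a \<open>p\<close>-group have \<open>p\<close>-power size, so every orbit with more than one point has size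
  divisible by \<open>p\<close>. Were \<open>e\<close> the only fixed point, the size of \<open>E\<close> would be \<open>1\<close> modulo \<open>p\<close>.\<close>

lemma p_group_action_second_fixed_point:
  fixes p n :: nat
  assumes "group_action G E f" and "Factorial_Ring.prime p" and ord: "order G = p ^ n"
    and E: "finite E" "p dvd card E"
    and e: "e \<in> E" "\<And>g. g \<in> carrier G \<Longrightarrow> f g e = e"
  obtains e' where "e' \<in> E" "e' \<noteq> e" "\<And>g. g \<in> carrier G \<Longrightarrow> f g e' = e'"
proof (rule ccontr)
  interpret group_action G E f by fact
  interpret G: group G using group_hom by (simp add: group_hom_def)
  assume "\<not> thesis"
  with that have no: "\<exists>g\<in>carrier G. f g x \<noteq> x" if "x \<in> E" "x \<noteq> e" for x
    using \<open>x \<in> E\<close> \<open>x \<noteq> e\<close> by blast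
  have orb_e: "orbit G f e = {e}"
    using e G.one_closed unfolding orbit_def by force
  then have e_mem: "{e} \<in> orbits G E f"
    using e(1) unfolding orbits_def by auto
  have dvd: "p dvd card X" if X: "X \<in> orbits G E f - {{e}}" for X
  proof -
    obtain x where x: "x \<in> E" "X = orbit G f x"
      using X unfolding orbits_def by auto
    have "x \<noteq> e"
      using X x orb_e by auto
    then obtain g where g: "g \<in> carrier G" "f g x \<noteq> x"
      using no x(1) by blast
    have "card X dvd p ^ n"
      using orbit_stabilizer_theorem[OF x(1)] ord x(2) by (metis dvd_triv_left)
    then obtain i where i: "card X = p ^ i"
      using \<open>Factorial_Ring.prime p\<close> by (auto simp: divides_primepow_nat)
    have "f g x \<in> X" "x \<in> X"
      using g x orbit_refl by (auto simp: orbit_def)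
    then have "card X \<noteq> 1"
      using g(2) by (metis card_1_singletonE singletonD)
    then have "i \<noteq> 0"
      using i by (metis power_0)
    then show ?thesis
      using i by simp
  qed
  have fin: "finite (orbits G E f)"
    using E(1) orbits_coverture by (metis finite_UnionD)
  have "card E = (\<Sum>X\<in>orbits G E f. card X)"
    using disjoint_sum[OF E(1), of "\<lambda>_. 1 :: nat"] by simp
  also have "\<dots> = card {e} + (\<Sum>X\<in>orbits G E f - {{e}}. card X)"
    by (rule sum.remove[OF fin e_mem])
  finally have "p dvd 1 + (\<Sum>X\<in>orbits G E f - {{e}}. card X)"
    using E(2) by simp
  moreover have "p dvd (\<Sum>X\<in>orbits G E f - {{e}}. card X)"
    by (rule dvd_sum) (rule dvd)
  ultimately have "p dvd 1"
    using dvd_add_left_iff by blast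
  then show False
    using \<open>Factorial_Ring.prime p\<close> by auto
qed

text \<open>A subgroup \<open>R\<close> permutes its own left cosets by left multiplication, and fixes the coset \<open>x R\<close>
  exactly when \<open>x\<^sup>-\<^sup>1 R x \<subseteq> R\<close>. The coset \<open>R\<close> itself is fixed and the number of cosets is divisible by
  \<open>p\<close>, so a second coset is fixed.\<close>

lemma (in group) p_group_normalizer_grows:
  fixes p n :: nat
  assumes p: "Factorial_Ring.prime p" and ord: "order G = p ^ n"
    and R: "subgroup R G" "R \<noteq> carrier G"
  obtains x where "x \<in> carrier G" "x \<notin> R" "\<And>r. r \<in> R \<Longrightarrow> inv x \<otimes> r \<otimes> x \<in> R"
proof -
  let ?E = "lcosets R" and ?f = "\<lambda>r. restrict (\<lambda>C. r <# C) (lcosets R)"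
  have sub: "R \<subseteq> carrier G"
    using R(1) by (rule subgroup.subset)
  have fin: "finite (carrier G)"
    using ord p order_gt_0_iff_finite prime_gt_0_nat by simp
  have "group_action G ?E ?f"
    by (rule group_actionI[OF is_group])
      (auto simp: LCOSETS_def lcos_m_assoc[OF sub] lcos_mult_one l_coset_subset_G[OF sub] m_assoc)
  then have act: "group_action (G\<lparr>carrier := R\<rparr>) ?E ?f"
    by (rule group_action.induced_action[OF _ R(1)])
  have "card R dvd p ^ n"
    using lagrange[OF R(1)] ord by (metis dvd_triv_right)
  then obtain i where i: "card R = p ^ i"
    using p by (auto simp: divides_primepow_nat)
  have lag: "card ?E * card R = p ^ n"
    using l_lagrange[OF fin R(1)] ord by simp
  have "card ?E dvd p ^ n"
    using lag by (metis dvd_triv_left)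
  then obtain j where j: "card ?E = p ^ j"
    using p by (auto simp: divides_primepow_nat)
  have "card R < p ^ n"
    using R(2) sub fin ord by (metis order_def psubset_card_mono psubsetI)
  then have "j \<noteq> 0"
    using lag j by (cases j) auto
  then have dvd: "p dvd card ?E"
    using j by simp
  have finE: "finite ?E"
    using fin by (simp add: LCOSETS_def)
  have RE: "R \<in> ?E"
    using lcos_mult_one[OF sub] one_closed by (force simp: LCOSETS_def)
  have fixR: "?f r R = R" if "r \<in> carrier (G\<lparr>carrier := R\<rparr>)" for r
    using that RE R(1) by (simp add: coset_join3[OF _ R(1)] subsetD[OF sub])
  have ordR: "order (G\<lparr>carrier := R\<rparr>) = p ^ i"
    using i by (simp add: order_def)
  obtain C where C: "C \<in> ?E" "C \<noteq> R" "\<And>r. r \<in> R \<Longrightarrow> ?f r C = C"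
    using p_group_action_second_fixed_point[OF act p ordR finE dvd RE fixR] by auto
  obtain x where x: "x \<in> carrier G" "C = x <# R"
    using C(1) by (auto simp: LCOSETS_def)
  show thesis
  proof
    show "x \<in> carrier G" by fact
    show "x \<notin> R"
      using C(2) x coset_join3[OF x(1) R(1)] by blast
    show "inv x \<otimes> r \<otimes> x \<in> R" if r: "r \<in> R" for r
    proof -
      have rG: "r \<in> carrier G"
        using r sub by blast
      have "r \<otimes> x \<in> r <# C"
        using lcos_self[OF x(1) R(1)] x(2) unfolding l_coset_def by blast
      also have "r <# C = C"
        using C(3)[OF r] C(1) by simp
      finally have "inv x \<otimes> (r \<otimes> x) \<in> R"
        using subgroup.lcos_module_imp[OF R(1) is_group x(1)] x(2) by simp
      then show ?thesis
        using rG x(1) by (simp add: m_assoc)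
    qed
  qed
qed

text \<open>If another prime \<open>r\<close> divided the order, Sylow's theorem would give a subgroup of order \<open>r\<close>, all
  of whose elements have order dividing both \<open>r\<close> and a power of \<open>p\<close>.\<close>

lemma (in group) order_eq_prime_power:
  fixes p :: nat
  assumes fin: "finite (carrier G)" and p: "Factorial_Ring.prime p"
    and el: "\<And>x. x \<in> carrier G \<Longrightarrow> \<exists>n. x [^] (p ^ n) = \<one>"
  obtains n where "order G = p ^ n"
proof -
  have pos: "order G > 0"
    using fin order_gt_0_iff_finite by simp
  have "r = p" if r: "Factorial_Ring.prime r" "r dvd order G" for r :: nat
  proof (rule ccontr)
    assume "r \<noteq> p"
    obtain m where "order G = r ^ 1 * m"
      using r(2) by auto
    then obtain H where H: "subgroup H G" "card H = r ^ 1"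
      using sylow_thm[OF r(1) is_group _ fin] by blast
    interpret H: group "G\<lparr>carrier := H\<rparr>"
      using H(1) by (rule subgroup_imp_group)
    have "H \<noteq> {\<one>}"
      using H(2) r(1) by auto
    then obtain x where x: "x \<in> H" "x \<noteq> \<one>"
      using subgroup.one_closed[OF H(1)] by blast
    then have xG: "x \<in> carrier G"
      using subgroup.subset[OF H(1)] by blast
    have "x [^]\<^bsub>G\<lparr>carrier := H\<rparr>\<^esub> order (G\<lparr>carrier := H\<rparr>) = \<one>"
      using H.pow_order_eq_1 x(1) by simp
    then have "x [^] r = \<one>"
      using H(2) by (simp add: order_def nat_pow_consistent[symmetric])
    then have "ord x dvd r"
      using xG by (simp add: pow_eq_id)
    moreover obtain n where "x [^] (p ^ n) = \<one>"
      using el xG by blast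
    then have "ord x dvd p ^ n"
      using xG by (simp add: pow_eq_id)
    moreover have "coprime r (p ^ n)"
      using primes_coprime[OF r(1) p \<open>r \<noteq> p\<close>] by simp
    ultimately have "ord x = 1"
      by (meson coprime_common_divisor_nat)
    then show False
      using x(2) xG ord_eq_1 by blast
  qed
  note only_p = this
  obtain b i where b: "order G = p ^ i * b" "\<not> p dvd b"
    using multiplicity_decompose'[of "order G" p] pos p not_prime_unit by (metis gr_implies_not0)
  have "b = 1"
    using only_p b prime_factor_nat[of b] by (metis dvd_mult)
  with b show thesis
    using that by simp
qed

section \<open>Additive maps of p-power order\<close>

lemma prime_dvd_choose_prime_power:
  fixes p :: nat
  assumes p: "Factorial_Ring.prime p" and "0 < k" "k < p ^ n"
  shows "p dvd (p ^ n choose k)"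
proof (rule ccontr)
  assume "\<not> p dvd (p ^ n choose k)"
  then have "coprime (p ^ n) (p ^ n choose k)"
    using p by (simp add: prime_imp_coprime)
  moreover have "k * (p ^ n choose k) = p ^ n * ((p ^ n - 1) choose (k - 1))"
    using times_binomial_minus1_eq[of k "p ^ n"] \<open>0 < k\<close> by simp
  then have "p ^ n dvd k * (p ^ n choose k)"
    by simp
  ultimately have "p ^ n dvd k"
    by (metis coprime_dvd_mult_left_iff)
  then show False
    using \<open>0 < k\<close> \<open>k < p ^ n\<close> by (simp add: nat_dvd_not_less)
qed

context abelian_group
begin

lemma diff_diff_diff:
  assumes "x \<in> carrier G" "y \<in> carrier G" "z \<in> carrier G" "w \<in> carrier G"
  shows "(x \<ominus> y) \<ominus> (z \<ominus> w) = (x \<ominus> z) \<ominus> (y \<ominus> w)"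
  using assms by (simp add: a_minus_def minus_add a_ac)

lemma diff_add_diff:
  assumes "x \<in> carrier G" "y \<in> carrier G" "z \<in> carrier G"
  shows "(x \<ominus> y) \<oplus> (y \<ominus> z) = x \<ominus> z"
  using assms by (simp add: a_minus_def a_assoc r_neg1)

lemma diff_cancel:
  assumes "x \<in> carrier G" "y \<in> carrier G"
  shows "(x \<ominus> y) \<oplus> y = x"
  using assms by (simp add: a_minus_def a_assoc l_neg)

text \<open>The binomial theorem for \<open>f = 1 + d\<close> where \<open>d = f - 1\<close>, in the ring of additive maps. Expanding
  powers of \<open>f\<close>, rather than of \<open>d\<close>, keeps all coefficients natural numbers.\<close>

lemma funpow_binomial:
  assumes f: "\<And>x. x \<in> carrier G \<Longrightarrow> f x \<in> carrier G"
    and f_add: "\<And>x y. x \<in> carrier G \<Longrightarrow> y \<in> carrier G \<Longrightarrow> f (x \<oplus> y) = f x \<oplus> f y"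
    and x: "x \<in> carrier G"
  shows "(f ^^ n) x = (\<Oplus>j\<in>{..n}. add_pow G (n choose j) (((\<lambda>y. f y \<ominus> y) ^^ j) x))"
  using x
proof (induction n arbitrary: x)
  case 0
  then show ?case
    by simp
next
  case (Suc n)
  let ?d = "\<lambda>y. f y \<ominus> y"
  have fn: "(f ^^ m) y \<in> carrier G" if "y \<in> carrier G" for m y
    using that by (induction m) (simp_all add: f)
  have fn_add: "(f ^^ m) (y \<oplus> z) = (f ^^ m) y \<oplus> (f ^^ m) z"
    if "y \<in> carrier G" "z \<in> carrier G" for m y z
    using that by (induction m) (simp_all add: f_add fn)
  have dj: "(?d ^^ j) y \<in> carrier G" if "y \<in> carrier G" for j y
    using that by (induction j) (simp_all add: f)
  have dx: "?d x \<in> carrier G"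
    using Suc.prems f by simp
  let ?t = "\<lambda>m j. add_pow G (m choose j) ((?d ^^ j) x)"
  have t: "?t m j \<in> carrier G" for m j
    using dj[OF Suc.prems] by simp
  have shift: "(?d ^^ j) (?d x) = (?d ^^ Suc j) x" for j
    by (simp only: funpow_Suc_right o_apply)
  \<comment> \<open>The induction hypothesis is applied to \<open>d x\<close> and to \<open>x\<close>; the two sums combine by Pascal's rule.\<close>
  have "(f ^^ Suc n) x = (f ^^ n) (?d x \<oplus> x)"
    using Suc.prems f by (simp add: funpow_Suc_right diff_cancel del: funpow.simps)
  also have "\<dots> = (f ^^ n) (?d x) \<oplus> (f ^^ n) x"
    using dx Suc.prems by (rule fn_add)
  also have "(f ^^ n) (?d x) = (\<Oplus>j\<in>{..n}. add_pow G (n choose j) ((?d ^^ Suc j) x))"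
    using Suc.IH[OF dx] by (simp only: shift)
  \<comment> \<open>The added term has coefficient \<open>n choose Suc n = 0\<close>; it makes the ranges match after the shift.\<close>
  also have "(f ^^ n) x = (\<Oplus>j\<in>{..Suc n}. ?t n j)"
  proof -
    have "(\<Oplus>j\<in>{..Suc n}. ?t n j) = ?t n (Suc n) \<oplus> (\<Oplus>j\<in>{..n}. ?t n j)"
      by (rule finsum_Suc) (simp add: t)
    then show ?thesis
      using Suc.IH[OF Suc.prems] t by (simp add: binomial_eq_0 finsum_closed Pi_def)
  qed
  also have "\<dots> = (\<Oplus>j\<in>{..n}. ?t n (Suc j)) \<oplus> ?t n 0"
    by (rule finsum_Suc2) (simp add: t)
  also have "(\<Oplus>j\<in>{..n}. add_pow G (n choose j) ((?d ^^ Suc j) x)) \<oplus>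
      ((\<Oplus>j\<in>{..n}. ?t n (Suc j)) \<oplus> ?t n 0) =
      ((\<Oplus>j\<in>{..n}. add_pow G (n choose j) ((?d ^^ Suc j) x)) \<oplus>
      (\<Oplus>j\<in>{..n}. ?t n (Suc j))) \<oplus> ?t n 0"
    by (rule a_assoc[symmetric]) (use dj[OF Suc.prems] in \<open>auto intro!: finsum_closed add.nat_pow_closed simp: Suc.prems simp del: funpow.simps\<close>)
  also have "(\<Oplus>j\<in>{..n}. add_pow G (n choose j) ((?d ^^ Suc j) x)) \<oplus> (\<Oplus>j\<in>{..n}. ?t n (Suc j)) =
      (\<Oplus>j\<in>{..n}. add_pow G (n choose j) ((?d ^^ Suc j) x) \<oplus> ?t n (Suc j))"
    by (rule finsum_addf[symmetric]) (use dj[OF Suc.prems] in \<open>auto intro!: add.nat_pow_closed simp del: funpow.simps\<close>)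
  also have "\<dots> = (\<Oplus>j\<in>{..n}. ?t (Suc n) (Suc j))"
    by (rule finsum_cong') (use dj[OF Suc.prems] in \<open>auto simp: add.nat_pow_mult simp del: funpow.simps\<close>)
  also have "?t n 0 = ?t (Suc n) 0"
    by simp
  also have "(\<Oplus>j\<in>{..n}. ?t (Suc n) (Suc j)) \<oplus> ?t (Suc n) 0 = (\<Oplus>j\<in>{..Suc n}. ?t (Suc n) j)"
    by (rule finsum_Suc2[symmetric]) (simp add: t)
  finally show ?case .
qed

text \<open>In characteristic \<open>p\<close> the binomial expansion of \<open>f\<close> raised to the power \<open>p ^ n\<close> keeps only its two
  outer terms, so \<open>x = x + d x\<close> with \<open>d\<close> the \<open>p ^ n\<close>-th power of \<open>f - 1\<close>.\<close>

lemma unipotent_if_prime_power_order: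
  fixes p n :: nat
  assumes f: "\<And>x. x \<in> carrier G \<Longrightarrow> f x \<in> carrier G"
    and f_add: "\<And>x y. x \<in> carrier G \<Longrightarrow> y \<in> carrier G \<Longrightarrow> f (x \<oplus> y) = f x \<oplus> f y"
    and p: "Factorial_Ring.prime p" and tors: "\<And>x. x \<in> carrier G \<Longrightarrow> add_pow G p x = \<zero>"
    and x: "x \<in> carrier G" and period: "(f ^^ (p ^ n)) x = x"
  shows "((\<lambda>y. f y \<ominus> y) ^^ (p ^ n)) x = \<zero>"
proof -
  let ?d = "\<lambda>y. f y \<ominus> y"
  let ?t = "\<lambda>j. add_pow G (p ^ n choose j) ((?d ^^ j) x)"
  have dj: "(?d ^^ j) x \<in> carrier G" for j
    using x by (induction j) (simp_all add: f)
  have pos: "0 < p ^ n"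
    using p prime_gt_0_nat by simp
  have mid: "?t j = \<zero>" if "j \<in> {..p ^ n} - {0, p ^ n}" for j
  proof -
    obtain c where "p ^ n choose j = p * c"
      using prime_dvd_choose_prime_power[OF p, of j n] \<open>j \<in> _\<close> by auto
    then show ?thesis
      using dj tors by (metis add.nat_pow_pow add.nat_pow_one)
  qed
  have "x = (\<Oplus>j\<in>{..p ^ n}. ?t j)"
    by (rule trans[OF period[symmetric] funpow_binomial[OF f f_add x]])
  also have "\<dots> = (\<Oplus>j\<in>{0, p ^ n}. ?t j)"
    by (rule add.finprod_mono_neutral_cong_right) (use mid dj in auto)
  also have "\<dots> = x \<oplus> (?d ^^ (p ^ n)) x"
    using pos dj x by (subst finsum_insert) auto
  finally show ?thesis
    by (simp only: add.l_cancel_one'[OF x dj])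
qed

end

section \<open>Vectors fixed modulo a submodule\<close>

text \<open>A \<open>\<int>G\<close>-module: which vectors are fixed modulo a subgroup of \<open>V\<close> depends only on addition
  and on the action. Unlike in \<^locale>\<open>group_action\<close>, the values of \<open>act\<close> outside \<open>V\<close> are arbitrary.\<close>

locale additive_action = G: group G + V: abelian_group V
  for G (structure) and V (structure) +
  fixes act :: "'a \<Rightarrow> 'c \<Rightarrow> 'c"
  assumes act_closed: "\<lbrakk>g \<in> carrier G; v \<in> carrier V\<rbrakk> \<Longrightarrow> act g v \<in> carrier V"
    and act_add: "\<lbrakk>g \<in> carrier G; v \<in> carrier V; w \<in> carrier V\<rbrakk> \<Longrightarrow>
      act g (v \<oplus>\<^bsub>V\<^esub> w) = act g v \<oplus>\<^bsub>V\<^esub> act g w"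
    and act_mult: "\<lbrakk>g \<in> carrier G; h \<in> carrier G; v \<in> carrier V\<rbrakk> \<Longrightarrow>
      act (g \<otimes>\<^bsub>G\<^esub> h) v = act g (act h v)"
    and act_one: "v \<in> carrier V \<Longrightarrow> act \<one>\<^bsub>G\<^esub> v = v"
begin

lemma act_minus:
  assumes g: "g \<in> carrier G" and v: "v \<in> carrier V" and w: "w \<in> carrier V"
  shows "act g (v \<ominus>\<^bsub>V\<^esub> w) = act g v \<ominus>\<^bsub>V\<^esub> act g w"
proof -
  have "act g v = act g (v \<ominus>\<^bsub>V\<^esub> w) \<oplus>\<^bsub>V\<^esub> act g w"
    using assms by (simp flip: act_add add: V.diff_cancel)
  then show ?thesis
    using assms by (simp add: act_closed a_minus_def V.a_assoc V.r_neg)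
qed

lemma act_pow:
  assumes "g \<in> carrier G" and "v \<in> carrier V"
  shows "act (g [^]\<^bsub>G\<^esub> (n :: nat)) v = (act g ^^ n) v"
  using assms by (induction n arbitrary: v) (simp_all add: act_one act_mult act_closed funpow_swap1)

definition stabilizer_mod :: "'c set \<Rightarrow> 'c \<Rightarrow> 'a set" where
  "stabilizer_mod N v = {g \<in> carrier G. act g v \<ominus>\<^bsub>V\<^esub> v \<in> N}"

context
  fixes N
  assumes N: "additive_subgroup N V"
    and N_stable: "\<And>g v. g \<in> carrier G \<Longrightarrow> v \<in> N \<Longrightarrow> act g v \<in> N"
begin

interpretation N: additive_subgroup N V by (rule N)

lemma N_diff: "a \<in> N \<Longrightarrow> b \<in> N \<Longrightarrow> a \<ominus>\<^bsub>V\<^esub> b \<in> N"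
  by (simp add: a_minus_def N.a_inv_closed)

text \<open>The stabilizer of the coset \<open>v + N\<close> under the action on \<open>V / N\<close>. Closure under products rests on
  \<open>g h v - v = g (h v - v) + (g v - v)\<close>.\<close>

lemma subgroup_stabilizer_mod:
  assumes v: "v \<in> carrier V"
  shows "subgroup (stabilizer_mod N v) G"
proof (rule G.subgroupI)
  have "\<one>\<^bsub>G\<^esub> \<in> stabilizer_mod N v"
    using v by (simp add: stabilizer_mod_def act_one V.r_neg a_minus_def)
  then show "stabilizer_mod N v \<noteq> {}"
    by blast
next
  fix g assume g: "g \<in> stabilizer_mod N v"
  then have gG: "g \<in> carrier G" and gN: "act g v \<ominus>\<^bsub>V\<^esub> v \<in> N"
    by (auto simp: stabilizer_mod_def)
  have "act (inv\<^bsub>G\<^esub> g) (act g v \<ominus>\<^bsub>V\<^esub> v) = v \<ominus>\<^bsub>V\<^esub> act (inv\<^bsub>G\<^esub> g) v"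
    using gG v by (simp add: act_minus act_closed act_one flip: act_mult)
  then have "\<ominus>\<^bsub>V\<^esub> (v \<ominus>\<^bsub>V\<^esub> act (inv\<^bsub>G\<^esub> g) v) \<in> N"
    using N_stable[OF _ gN] gG N.a_inv_closed by (metis G.inv_closed)
  then show "inv\<^bsub>G\<^esub> g \<in> stabilizer_mod N v"
    using gG v by (simp add: stabilizer_mod_def a_minus_def V.minus_add act_closed V.a_comm)
next
  fix g h assume "g \<in> stabilizer_mod N v" "h \<in> stabilizer_mod N v"
  then have gh: "g \<in> carrier G" "h \<in> carrier G"
    and N: "act g v \<ominus>\<^bsub>V\<^esub> v \<in> N" "act h v \<ominus>\<^bsub>V\<^esub> v \<in> N"
    by (auto simp: stabilizer_mod_def)
  have "act (g \<otimes>\<^bsub>G\<^esub> h) v \<ominus>\<^bsub>V\<^esub> v = act g (act h v \<ominus>\<^bsub>V\<^esub> v) \<oplus>\<^bsub>V\<^esub> (act g v \<ominus>\<^bsub>V\<^esub> v)"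
    using gh v by (simp add: act_minus act_closed act_mult V.diff_add_diff)
  also have "\<dots> \<in> N"
    using N gh(1) N_stable by simp
  finally show "g \<otimes>\<^bsub>G\<^esub> h \<in> stabilizer_mod N v"
    using gh by (simp add: stabilizer_mod_def)
qed (auto simp: stabilizer_mod_def)

text \<open>The vectors that \<open>S\<close> fixes modulo \<open>N\<close> are mapped to each other by every \<open>q\<close> with \<open>q\<^sup>-\<^sup>1 S q \<subseteq> S\<close>, since
  \<open>s q v = q (q\<^sup>-\<^sup>1 s q) v\<close>; hence also by \<open>q - 1\<close>.\<close>

lemma stabilizer_mod_difference:
  assumes v: "v \<in> carrier V" and S: "S \<subseteq> stabilizer_mod N v"
    and q: "q \<in> carrier G" and normalizes: "\<And>s. s \<in> S \<Longrightarrow> inv\<^bsub>G\<^esub> q \<otimes>\<^bsub>G\<^esub> s \<otimes>\<^bsub>G\<^esub> q \<in> S"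
  shows "S \<subseteq> stabilizer_mod N (act q v \<ominus>\<^bsub>V\<^esub> v)"
proof
  fix s assume s: "s \<in> S"
  then have sG: "s \<in> carrier G" and sv: "act s v \<ominus>\<^bsub>V\<^esub> v \<in> N"
    using S by (auto simp: stabilizer_mod_def)
  let ?s' = "inv\<^bsub>G\<^esub> q \<otimes>\<^bsub>G\<^esub> s \<otimes>\<^bsub>G\<^esub> q"
  have s': "?s' \<in> carrier G" "act ?s' v \<ominus>\<^bsub>V\<^esub> v \<in> N"
    using normalizes[OF s] S by (auto simp: stabilizer_mod_def)
  have "q \<otimes>\<^bsub>G\<^esub> ?s' = s \<otimes>\<^bsub>G\<^esub> q"
    using q sG by (simp add: G.m_assoc[symmetric])
  then have "act q (act ?s' v) = act s (act q v)"
    using q sG s'(1) v by (metis act_mult)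
  then have "act s (act q v \<ominus>\<^bsub>V\<^esub> v) \<ominus>\<^bsub>V\<^esub> (act q v \<ominus>\<^bsub>V\<^esub> v) =
      act q (act ?s' v \<ominus>\<^bsub>V\<^esub> v) \<ominus>\<^bsub>V\<^esub> (act s v \<ominus>\<^bsub>V\<^esub> v)"
    using q sG s'(1) v by (simp add: act_minus act_closed V.diff_diff_diff)
  also have "\<dots> \<in> N"
    using N_diff N_stable[OF q s'(2)] sv by blast
  finally show "s \<in> stabilizer_mod N (act q v \<ominus>\<^bsub>V\<^esub> v)"
    using sG by (simp add: stabilizer_mod_def)
qed

text \<open>A vector with maximal stabilizer modulo \<open>N\<close> is fixed by everything: otherwise the stabilizer is
  normalized by some further \<open>q\<close>, and applying the nilpotent operator \<open>q - 1\<close> until just before the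
  result falls into \<open>N\<close> yields a vector with a larger one.\<close>

lemma p_group_fixes_vector_mod:
  fixes p n :: nat
  assumes p: "Factorial_Ring.prime p" and ord: "order G = p ^ n"
    and tors: "\<And>v. v \<in> carrier V \<Longrightarrow> add_pow V p v = \<zero>\<^bsub>V\<^esub>"
    and v: "v \<in> carrier V" "v \<notin> N"
  obtains u where "u \<in> carrier V" "u \<notin> N"
    "\<And>g. g \<in> carrier G \<Longrightarrow> act g u \<ominus>\<^bsub>V\<^esub> u \<in> N"
proof -
  have fin: "finite (carrier G)"
    using ord p G.order_gt_0_iff_finite prime_gt_0_nat by simp
  let ?P = "\<lambda>u. u \<in> carrier V \<and> u \<notin> N"
  have "\<forall>u. ?P u \<longrightarrow> card (stabilizer_mod N u) \<le> card (carrier G)"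
    by (auto intro!: card_mono fin simp: stabilizer_mod_def)
  then obtain u where u: "u \<in> carrier V" "u \<notin> N"
    and max: "\<And>w. ?P w \<Longrightarrow> card (stabilizer_mod N w) \<le> card (stabilizer_mod N u)"
    using ex_has_greatest_nat[of ?P v "\<lambda>u. card (stabilizer_mod N u)" "Suc (card (carrier G))"] v
    by (auto simp only: simp_thms less_Suc_eq_le)
  let ?S = "stabilizer_mod N u"
  have "?S = carrier G"
  proof (rule ccontr)
    assume "?S \<noteq> carrier G"
    then obtain q where q: "q \<in> carrier G" "q \<notin> ?S"
      and norm: "\<And>s. s \<in> ?S \<Longrightarrow> inv\<^bsub>G\<^esub> q \<otimes>\<^bsub>G\<^esub> s \<otimes>\<^bsub>G\<^esub> q \<in> ?S"
      using G.p_group_normalizer_grows[OF p ord subgroup_stabilizer_mod[OF u(1)]] by blast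
    let ?d = "\<lambda>w. act q w \<ominus>\<^bsub>V\<^esub> w"
    have dj: "(?d ^^ j) u \<in> carrier V \<and> ?S \<subseteq> stabilizer_mod N ((?d ^^ j) u)" for j
    proof (induction j)
      case (Suc j)
      then show ?case
        using stabilizer_mod_difference[OF _ _ q(1) norm] q(1) by (simp add: act_closed)
    qed (simp add: u)
    have "(act q ^^ (p ^ n)) u = u"
      using G.pow_order_eq_1[OF q(1)] ord act_pow[OF q(1) u(1), of "p ^ n"] u(1) by (simp add: act_one)
    then have "(?d ^^ (p ^ n)) u = \<zero>\<^bsub>V\<^esub>"
      using V.unipotent_if_prime_power_order[of "act q" p u n] p tors u(1) q(1)
      by (simp add: act_closed act_add)
    then have "(?d ^^ (p ^ n)) u \<in> N"
      by simp
    moreover have "(?d ^^ 0) u \<notin> N"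
      using u(2) by simp
    ultimately obtain j where j: "(?d ^^ j) u \<notin> N" "(?d ^^ Suc j) u \<in> N"
      using ex_least_nat_less[of "\<lambda>j. (?d ^^ j) u \<in> N" "p ^ n"] by blast
    then have "q \<in> stabilizer_mod N ((?d ^^ j) u)"
      using q(1) by (simp add: stabilizer_mod_def)
    then have "?S \<subset> stabilizer_mod N ((?d ^^ j) u)"
      using dj q(2) by blast
    then have "card ?S < card (stabilizer_mod N ((?d ^^ j) u))"
      using fin by (intro psubset_card_mono) (auto simp: stabilizer_mod_def)
    then show False
      using max[of "(?d ^^ j) u"] dj j(1) by simp
  qed
  with u show thesis
    using that by (auto simp: stabilizer_mod_def)
qed

end

end

section \<open>Monomials in the group algebra\<close>

definition monomial :: "('k, 'n) ring_scheme \<Rightarrow> 'k \<Rightarrow> 'g \<Rightarrow> 'g \<Rightarrow> 'k" where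
  "monomial K c x = (\<lambda>g. if g = x then c else \<zero>\<^bsub>K\<^esub>)"

lemma basis_eq_monomial: "group_algebra_basis K g = monomial K \<one>\<^bsub>K\<^esub> g"
  by (simp add: group_algebra_basis_def monomial_def)

context
  fixes K (structure) and G (structure)
  assumes ring_K: "ring K" and group_G: "group G"
begin

interpretation K: ring K by (rule ring_K)
interpretation G: group G by (rule group_G)

lemma monomial_closed:
  assumes "c \<in> carrier K" "x \<in> carrier G"
  shows "monomial K c x \<in> carrier (group_algebra K G)"
proof -
  have "coeff_support K G (monomial K c x) \<subseteq> {x}"
    by (auto simp: coeff_support_def monomial_def)
  then show ?thesis
    using assms finite_subset by (fastforce simp: group_algebra_def monomial_def)
qed

lemma monomial_zero: "monomial K \<zero> x = \<zero>\<^bsub>group_algebra K G\<^esub>"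
  by (simp add: monomial_def group_algebra_def)

lemma monomial_one: "monomial K \<one> \<one>\<^bsub>G\<^esub> = \<one>\<^bsub>group_algebra K G\<^esub>"
  by (simp add: monomial_def group_algebra_def)

lemma monomial_add:
  assumes "c \<in> carrier K" "d \<in> carrier K"
  shows "monomial K (c \<oplus> d) x = monomial K c x \<oplus>\<^bsub>group_algebra K G\<^esub> monomial K d x"
  using assms by (auto simp: monomial_def group_algebra_def)

lemma monomial_mult:
  assumes c: "c \<in> carrier K" "d \<in> carrier K" and x: "x \<in> carrier G" "y \<in> carrier G"
  shows "monomial K c x \<otimes>\<^bsub>group_algebra K G\<^esub> monomial K d y = monomial K (c \<otimes> d) (x \<otimes>\<^bsub>G\<^esub> y)"
proof
  fix g
  have supp: "coeff_support K G (monomial K c x) = (if c = \<zero> then {} else {x})"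
    using x(1) by (auto simp: coeff_support_def monomial_def)
  have "inv\<^bsub>G\<^esub> x \<otimes>\<^bsub>G\<^esub> g = y \<longleftrightarrow> g = x \<otimes>\<^bsub>G\<^esub> y" if "g \<in> carrier G"
    using that x by (metis G.inv_closed G.inv_inv G.inv_solve_left)
  then show "(monomial K c x \<otimes>\<^bsub>group_algebra K G\<^esub> monomial K d y) g =
      monomial K (c \<otimes> d) (x \<otimes>\<^bsub>G\<^esub> y) g"
    using c x by (auto simp: group_algebra_def supp) (auto simp: monomial_def)
qed

lemma split_off_monomial:
  assumes a: "a \<in> carrier (group_algebra K G)" and x: "x \<in> carrier G"
  shows "a = monomial K (a x) x \<oplus>\<^bsub>group_algebra K G\<^esub> a(x := \<zero>)"
    and "a(x := \<zero>) \<in> carrier (group_algebra K G)"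
    and "coeff_support K G (a(x := \<zero>)) = coeff_support K G a - {x}"
proof -
  show supp: "coeff_support K G (a(x := \<zero>)) = coeff_support K G a - {x}"
    by (auto simp: coeff_support_def)
  show "a(x := \<zero>) \<in> carrier (group_algebra K G)"
    using a supp by (auto simp: group_algebra_def)
  have "a g \<in> carrier K" for g
    using a by (cases "g \<in> carrier G") (auto simp: group_algebra_def)
  then show "a = monomial K (a x) x \<oplus>\<^bsub>group_algebra K G\<^esub> a(x := \<zero>)"
    by (auto simp: group_algebra_def monomial_def)
qed

end

section \<open>Left modules\<close>

lemma (in left_module) zero_smult:
  assumes "v \<in> carrier M"
  shows "\<zero> \<odot>\<^bsub>M\<^esub> v = \<zero>\<^bsub>M\<^esub>"
proof -
  have "\<zero> \<odot>\<^bsub>M\<^esub> v \<oplus>\<^bsub>M\<^esub> \<zero> \<odot>\<^bsub>M\<^esub> v = \<zero> \<odot>\<^bsub>M\<^esub> v"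
    using smult_l_distr[of \<zero> \<zero> v] assms by simp
  then show ?thesis
    using assms smult_closed by (metis M.add.r_cancel_one R.zero_closed)
qed

lemma (in left_module) smult_zero:
  assumes "a \<in> carrier R"
  shows "a \<odot>\<^bsub>M\<^esub> \<zero>\<^bsub>M\<^esub> = \<zero>\<^bsub>M\<^esub>"
proof -
  have "a \<odot>\<^bsub>M\<^esub> \<zero>\<^bsub>M\<^esub> \<oplus>\<^bsub>M\<^esub> a \<odot>\<^bsub>M\<^esub> \<zero>\<^bsub>M\<^esub> = a \<odot>\<^bsub>M\<^esub> \<zero>\<^bsub>M\<^esub>"
    using smult_r_distr[of a "\<zero>\<^bsub>M\<^esub>" "\<zero>\<^bsub>M\<^esub>"] assms by simp
  then show ?thesis
    using assms smult_closed by (metis M.add.r_cancel_one M.zero_closed)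
qed

lemma (in left_module) smult_diff:
  assumes "a \<in> carrier R" "v \<in> carrier M" "w \<in> carrier M"
  shows "a \<odot>\<^bsub>M\<^esub> (v \<ominus>\<^bsub>M\<^esub> w) = a \<odot>\<^bsub>M\<^esub> v \<ominus>\<^bsub>M\<^esub> a \<odot>\<^bsub>M\<^esub> w"
proof -
  have "a \<odot>\<^bsub>M\<^esub> v = a \<odot>\<^bsub>M\<^esub> (v \<ominus>\<^bsub>M\<^esub> w) \<oplus>\<^bsub>M\<^esub> a \<odot>\<^bsub>M\<^esub> w"
    using assms by (simp flip: smult_r_distr add: M.diff_cancel)
  then show ?thesis
    using assms by (simp add: smult_closed a_minus_def M.a_assoc M.r_neg)
qed

lemma (in irreducible_module) generated_by_nonzero:
  assumes w: "w \<in> carrier M" "w \<noteq> \<zero>\<^bsub>M\<^esub>" and v: "v \<in> carrier M"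
  obtains a where "a \<in> carrier R" "v = a \<odot>\<^bsub>M\<^esub> w"
proof -
  let ?C = "(\<lambda>a. a \<odot>\<^bsub>M\<^esub> w) ` carrier R"
  have "subgroup ?C (add_monoid M)"
  proof (rule M.add.subgroupI)
    fix y assume "y \<in> ?C"
    then obtain a where a: "a \<in> carrier R" "y = a \<odot>\<^bsub>M\<^esub> w"
      by blast
    have "\<ominus> a \<odot>\<^bsub>M\<^esub> w \<oplus>\<^bsub>M\<^esub> y = \<zero>\<^bsub>M\<^esub>"
      using smult_l_distr[of "\<ominus> a" a w] a w by (simp add: R.l_neg zero_smult)
    then have "\<ominus>\<^bsub>M\<^esub> y = \<ominus> a \<odot>\<^bsub>M\<^esub> w"
      using a w by (metis M.minus_equality R.a_inv_closed smult_closed)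
    then show "\<ominus>\<^bsub>M\<^esub> y \<in> ?C"
      using a by blast
  next
    fix y z assume "y \<in> ?C" "z \<in> ?C"
    then show "y \<oplus>\<^bsub>M\<^esub> z \<in> ?C"
      using w by (auto simp flip: smult_l_distr)
  qed (use w smult_closed in auto)
  then have "submodule ?C R M"
    by (rule submodule.intro)
      (use w in \<open>auto simp: submodule_axioms_def simp flip: smult_assoc1\<close>)
  moreover have "w \<in> ?C"
    using smult_one[OF w(1)] by (metis R.one_closed image_eqI)
  ultimately have "?C = carrier M"
    using submodule_cases w(2) by blast
  then show thesis
    using v that by blast
qed

section \<open>Modules over a group algebra\<close>

locale group_algebra_module =
  K?: ring K + G: group G + V: left_module "group_algebra K G" V
  for K (structure) and G (structure) and V (structure)
begin

abbreviation translate where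
  "translate g v \<equiv> group_algebra_basis K g \<odot>\<^bsub>V\<^esub> v"

lemmas monomial_closed = monomial_closed[OF K.ring_axioms G.group_axioms]
lemmas monomial_zero = monomial_zero[OF K.ring_axioms G.group_axioms]
lemmas monomial_one = monomial_one[OF K.ring_axioms G.group_axioms]
lemmas monomial_add = monomial_add[OF K.ring_axioms G.group_axioms]
lemmas monomial_mult = monomial_mult[OF K.ring_axioms G.group_axioms]
lemmas split_off_monomial = split_off_monomial[OF K.ring_axioms G.group_axioms]

lemma basis_closed: "g \<in> carrier G \<Longrightarrow> group_algebra_basis K g \<in> carrier (group_algebra K G)"
  by (rule group_algebra_basis_closed[OF K.ring_axioms G.group_axioms])

lemma additive_action_translate:
  assumes "subgroup Q G"
  shows "additive_action (G\<lparr>carrier := Q\<rparr>) V translate"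
proof -
  have Q: "q \<in> carrier G" if "q \<in> Q" for q
    using that subgroup.subset[OF assms] by blast
  show ?thesis
  proof (intro additive_action.intro additive_action_axioms.intro)
    show "group (G\<lparr>carrier := Q\<rparr>)"
      using assms by (rule G.subgroup_imp_group)
    show "abelian_group V" ..
  next
    fix g h v assume "g \<in> carrier (G\<lparr>carrier := Q\<rparr>)" "h \<in> carrier (G\<lparr>carrier := Q\<rparr>)" "v \<in> carrier V"
    then show "translate (g \<otimes>\<^bsub>G\<lparr>carrier := Q\<rparr>\<^esub> h) v = translate g (translate h v)"
      using Q by (simp flip: V.smult_assoc1 add: basis_closed)
        (simp add: basis_eq_monomial monomial_mult)
  next
    fix v assume "v \<in> carrier V"
    then show "translate \<one>\<^bsub>G\<lparr>carrier := Q\<rparr>\<^esub> v = v"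
      using V.smult_one monomial_one
      by (simp add: basis_eq_monomial)
  qed (use Q in \<open>auto simp: basis_closed V.smult_closed V.smult_r_distr\<close>)
qed

text \<open>The natural number \<open>n\<close> acts on \<open>V\<close> as the element \<open>n 1\<close> of the group algebra, so \<open>V\<close> inherits the
  characteristic of the coefficient ring.\<close>

lemma add_pow_eq_monomial_smult:
  assumes "v \<in> carrier V"
  shows "add_pow V (n :: nat) v = monomial K (add_pow K n \<one>) \<one>\<^bsub>G\<^esub> \<odot>\<^bsub>V\<^esub> v"
proof (induction n)
  case 0
  then show ?case
    using assms by (simp add: monomial_zero V.zero_smult)
next
  case (Suc n)
  then show ?case
    using assms V.smult_one[OF assms]
    by (simp add: monomial_add V.smult_l_distr monomial_closed
        monomial_one)
qed

lemma add_pow_characteristic: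
  assumes "v \<in> carrier V" "add_pow K (p :: nat) \<one> = \<zero>"
  shows "add_pow V p v = \<zero>\<^bsub>V\<^esub>"
  using assms
  by (simp add: add_pow_eq_monomial_smult monomial_zero V.zero_smult)

text \<open>The \<open>KH\<close>-submodules of \<open>V\<close>. Testing monomials only makes this condition easy to verify;
  \<open>stable_smult\<close> extends it to all elements of \<open>KH\<close>, that is, to those with support in \<open>H\<close>.\<close>

definition stable :: "'c set \<Rightarrow> 'e set \<Rightarrow> bool" where
  "stable H N \<longleftrightarrow> additive_subgroup N V \<and>
     (\<forall>c\<in>carrier K. \<forall>h\<in>H. \<forall>m\<in>N. monomial K c h \<odot>\<^bsub>V\<^esub> m \<in> N)"

lemma stable_smult:
  assumes N: "stable H N" and H: "H \<subseteq> carrier G" and v: "v \<in> N"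
    and a: "a \<in> carrier (group_algebra K G)" "coeff_support K G a \<subseteq> H"
  shows "a \<odot>\<^bsub>V\<^esub> v \<in> N"
proof -
  interpret N: additive_subgroup N V
    using N by (simp add: stable_def)
  have vV: "v \<in> carrier V"
    using v N.a_subset by blast
  have "finite (coeff_support K G a)"
    using a(1) by (simp add: group_algebra_def)
  then show ?thesis
    using a
  proof (induction "coeff_support K G a" arbitrary: a rule: finite_induct)
    case empty
    then have "a = \<zero>\<^bsub>group_algebra K G\<^esub>"
      by (auto simp: coeff_support_def group_algebra_def fun_eq_iff)
    then show ?case
      using vV by (simp add: V.zero_smult)
  next
    case (insert x S)
    have x: "x \<in> H" "x \<in> carrier G"
      using insert.hyps(4) insert.prems(2) H by auto
    note split = split_off_monomial[OF insert.prems(1) x(2)]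
    have S: "S = coeff_support K G (a(x := \<zero>))"
      using split(3) insert.hyps(2,4) by auto
    have ax: "a x \<in> carrier K"
      using insert.prems(1) x(2) by (simp add: group_algebra_def)
    have "a(x := \<zero>) \<odot>\<^bsub>V\<^esub> v \<in> N"
      using insert.hyps(3)[OF S split(2)] insert.prems(2) split(3) by blast
    moreover have "monomial K (a x) x \<odot>\<^bsub>V\<^esub> v \<in> N"
      using N ax x(1) v by (simp add: stable_def)
    ultimately have "monomial K (a x) x \<odot>\<^bsub>V\<^esub> v \<oplus>\<^bsub>V\<^esub> a(x := \<zero>) \<odot>\<^bsub>V\<^esub> v \<in> N"
      by (rule N.a_closed[rotated])
    moreover have "a \<odot>\<^bsub>V\<^esub> v = monomial K (a x) x \<odot>\<^bsub>V\<^esub> v \<oplus>\<^bsub>V\<^esub> a(x := \<zero>) \<odot>\<^bsub>V\<^esub> v"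
      using V.smult_l_distr[OF monomial_closed[OF ax x(2)] split(2) vV] split(1) by simp
    ultimately show ?case
      by simp
  qed
qed

lemma stable_Union:
  assumes "\<C> \<noteq> {}" and chain: "\<And>M N. M \<in> \<C> \<Longrightarrow> N \<in> \<C> \<Longrightarrow> M \<subseteq> N \<or> N \<subseteq> M"
    and st: "\<And>N. N \<in> \<C> \<Longrightarrow> stable H N"
  shows "stable H (\<Union>\<C>)"
proof -
  have add: "additive_subgroup N V" if "N \<in> \<C>" for N
    using st that by (simp add: stable_def)
  have "subgroup (\<Union>\<C>) (add_monoid V)"
  proof (rule V.add.subgroupI)
    show "\<Union>\<C> \<subseteq> carrier V"
      using additive_subgroup.a_subset[OF add] by blast
    show "\<Union>\<C> \<noteq> {}"
      using \<open>\<C> \<noteq> {}\<close> additive_subgroup.zero_closed[OF add] by blast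
    show "\<ominus>\<^bsub>V\<^esub> x \<in> \<Union>\<C>" if "x \<in> \<Union>\<C>" for x
      using that additive_subgroup.a_inv_closed[OF add] by blast
    show "x \<oplus>\<^bsub>V\<^esub> y \<in> \<Union>\<C>" if xy: "x \<in> \<Union>\<C>" "y \<in> \<Union>\<C>" for x y
    proof -
      obtain N where "N \<in> \<C>" "x \<in> N" "y \<in> N"
        using xy chain by (metis UnionE subsetD)
      then show ?thesis
        using additive_subgroup.a_closed[OF add] by blast
    qed
  qed
  then show ?thesis
    using st unfolding stable_def additive_subgroup_def by blast
qed

lemma maximal_stable_avoiding:
  assumes H: "H \<subseteq> carrier G" and v: "v \<noteq> \<zero>\<^bsub>V\<^esub>"
  obtains N where "stable H N" "v \<notin> N"
    "\<And>N'. stable H N' \<Longrightarrow> N \<subseteq> N' \<Longrightarrow> N' \<noteq> N \<Longrightarrow> v \<in> N'"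
proof -
  let ?\<A> = "{N. stable H N \<and> v \<notin> N}"
  have "stable H {\<zero>\<^bsub>V\<^esub>}"
    using H V.M.add.triv_subgroup
    by (auto simp: stable_def additive_subgroup_def monomial_closed V.smult_zero subsetD)
  then have "{\<zero>\<^bsub>V\<^esub>} \<in> ?\<A>"
    using v by simp
  then have ne: "?\<A> \<noteq> {}"
    by blast
  have "\<exists>M\<in>?\<A>. \<forall>X\<in>?\<A>. M \<subseteq> X \<longrightarrow> X = M"
  proof (rule subset_Zorn_nonempty[OF ne])
    fix \<C> assume "\<C> \<noteq> {}" and "subset.chain ?\<A> \<C>"
    then have "\<C> \<subseteq> ?\<A>" "\<And>M N. M \<in> \<C> \<Longrightarrow> N \<in> \<C> \<Longrightarrow> M \<subseteq> N \<or> N \<subseteq> M"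
      unfolding subset_chain_def by blast+
    then have "stable H (\<Union>\<C>)"
      by (intro stable_Union \<open>\<C> \<noteq> {}\<close>) blast+
    then show "\<Union>\<C> \<in> ?\<A>"
      using \<open>\<C> \<subseteq> ?\<A>\<close> by blast
  qed
  then show thesis
    using that by blast
qed

text \<open>For \<open>h \<in> H\<close>, \<open>q \<in> Q\<close> and a scalar \<open>c\<close>, the identity \<open>(q - 1) c h = c h (h\<^sup>-\<^sup>1 q h - 1)\<close> moves the
  difference past the monomial, and \<open>h\<^sup>-\<^sup>1 q h\<close> is again in \<open>Q\<close>.\<close>

lemma stable_fixed_mod:
  assumes H: "subgroup H G" and Q: "subgroup Q G"
    and normal: "\<And>h q. h \<in> H \<Longrightarrow> q \<in> Q \<Longrightarrow> inv\<^bsub>G\<^esub> h \<otimes>\<^bsub>G\<^esub> q \<otimes>\<^bsub>G\<^esub> h \<in> Q"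
    and N: "stable H N"
  shows "stable H {m \<in> carrier V. \<forall>q\<in>Q. translate q m \<ominus>\<^bsub>V\<^esub> m \<in> N}" (is "stable H ?F")
proof -
  interpret N: additive_subgroup N V
    using N by (simp add: stable_def)
  have HG: "h \<in> carrier G" if "h \<in> H" for h
    using that subgroup.subset[OF H] by blast
  have QG: "q \<in> carrier G" if "q \<in> Q" for q
    using that subgroup.subset[OF Q] by blast
  have bc: "group_algebra_basis K q \<in> carrier (group_algebra K G)" if "q \<in> Q" for q
    using that QG basis_closed by blast
  have "subgroup ?F (add_monoid V)"
  proof (rule V.add.subgroupI)
    have "\<zero>\<^bsub>V\<^esub> \<in> ?F"
      using bc by (simp add: V.smult_zero V.M.r_neg a_minus_def)
    then show "?F \<noteq> {}"
      by blast
  next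
    fix m assume "m \<in> ?F"
    then have m: "m \<in> carrier V" "\<And>q. q \<in> Q \<Longrightarrow> translate q m \<ominus>\<^bsub>V\<^esub> m \<in> N"
      by auto
    have "translate q (\<ominus>\<^bsub>V\<^esub> m) \<ominus>\<^bsub>V\<^esub> (\<ominus>\<^bsub>V\<^esub> m) = \<ominus>\<^bsub>V\<^esub> (translate q m \<ominus>\<^bsub>V\<^esub> m)" if "q \<in> Q" for q
      using V.smult_diff[OF bc[OF that] V.M.zero_closed m(1)] m(1) bc[OF that]
      by (simp add: V.smult_zero a_minus_def V.M.minus_add V.smult_closed)
    then show "\<ominus>\<^bsub>V\<^esub> m \<in> ?F"
      using m N.a_inv_closed by simp
  next
    fix m m' assume "m \<in> ?F" "m' \<in> ?F"
    then have m: "m \<in> carrier V" "\<And>q. q \<in> Q \<Longrightarrow> translate q m \<ominus>\<^bsub>V\<^esub> m \<in> N"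
      and m': "m' \<in> carrier V" "\<And>q. q \<in> Q \<Longrightarrow> translate q m' \<ominus>\<^bsub>V\<^esub> m' \<in> N"
      by auto
    have "translate q (m \<oplus>\<^bsub>V\<^esub> m') \<ominus>\<^bsub>V\<^esub> (m \<oplus>\<^bsub>V\<^esub> m') =
        (translate q m \<ominus>\<^bsub>V\<^esub> m) \<oplus>\<^bsub>V\<^esub> (translate q m' \<ominus>\<^bsub>V\<^esub> m')" if "q \<in> Q" for q
      using m(1) m'(1) bc[OF that]
      by (simp add: V.smult_r_distr V.smult_closed a_minus_def V.M.minus_add V.M.a_ac)
    then show "m \<oplus>\<^bsub>V\<^esub> m' \<in> ?F"
      using m m' by simp
  qed auto
  moreover have "monomial K c h \<odot>\<^bsub>V\<^esub> m \<in> ?F" if c: "c \<in> carrier K" and h: "h \<in> H" and "m \<in> ?F" for c h m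
  proof -
    have m: "m \<in> carrier V" "\<And>q. q \<in> Q \<Longrightarrow> translate q m \<ominus>\<^bsub>V\<^esub> m \<in> N"
      using \<open>m \<in> ?F\<close> by auto
    have ch: "monomial K c h \<in> carrier (group_algebra K G)"
      using c h HG monomial_closed by blast
    have "translate q (monomial K c h \<odot>\<^bsub>V\<^esub> m) \<ominus>\<^bsub>V\<^esub> monomial K c h \<odot>\<^bsub>V\<^esub> m \<in> N" if q: "q \<in> Q" for q
    proof -
      let ?q' = "inv\<^bsub>G\<^esub> h \<otimes>\<^bsub>G\<^esub> q \<otimes>\<^bsub>G\<^esub> h"
      have q': "?q' \<in> Q"
        using normal h q by blast
      have "h \<otimes>\<^bsub>G\<^esub> ?q' = q \<otimes>\<^bsub>G\<^esub> h"
        using HG[OF h] QG[OF q] by (simp add: G.m_assoc[symmetric])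
      then have "monomial K \<one> q \<otimes>\<^bsub>group_algebra K G\<^esub> monomial K c h =
          monomial K c h \<otimes>\<^bsub>group_algebra K G\<^esub> monomial K \<one> ?q'"
        using c HG[OF h] QG[OF q] by (simp add: monomial_mult)
      then have "translate q (monomial K c h \<odot>\<^bsub>V\<^esub> m) = monomial K c h \<odot>\<^bsub>V\<^esub> translate ?q' m"
        using bc[OF q] bc[OF q'] ch m(1)
        by (simp flip: V.smult_assoc1 add: basis_eq_monomial)
      then have "translate q (monomial K c h \<odot>\<^bsub>V\<^esub> m) \<ominus>\<^bsub>V\<^esub> monomial K c h \<odot>\<^bsub>V\<^esub> m =
          monomial K c h \<odot>\<^bsub>V\<^esub> (translate ?q' m \<ominus>\<^bsub>V\<^esub> m)"
        using V.smult_diff[OF ch _ m(1)] bc[OF q'] m(1) by (simp add: V.smult_closed)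
      also have "\<dots> \<in> N"
        using N c h m(2)[OF q'] by (simp add: stable_def)
      finally show ?thesis .
    qed
    then show ?thesis
      using ch m(1) V.smult_closed by simp
  qed
  ultimately show ?thesis
    by (simp add: stable_def additive_subgroup_def)
qed

text \<open>Nakayama's lemma for the ideal of \<open>KH\<close> generated by the elements \<open>q - 1\<close> with \<open>q \<in> Q\<close>: no element
  of this ideal can fix a nonzero vector. Taking \<open>N\<close> maximal among the \<open>KH\<close>-submodules without \<open>v\<close>
  lets a single enlargement of \<open>N\<close> finish the proof, where the nilpotency of the ideal would require
  a whole filtration of \<open>V\<close>.\<close>

lemma augmentation_nakayama:
  fixes p n :: nat
  assumes p: "Factorial_Ring.prime p" "add_pow K p \<one> = \<zero>"
    and H: "subgroup H G" and Q: "subgroup Q G" "Q \<subseteq> H" "card Q = p ^ n"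
    and normal: "\<And>h q. h \<in> H \<Longrightarrow> q \<in> Q \<Longrightarrow> inv\<^bsub>G\<^esub> h \<otimes>\<^bsub>G\<^esub> q \<otimes>\<^bsub>G\<^esub> h \<in> Q"
    and a: "a \<in> carrier (group_algebra K G)" "coeff_support K G a \<subseteq> H"
    and x: "x \<in> Q" and v: "v \<in> carrier V" "a \<odot>\<^bsub>V\<^esub> (translate x v \<ominus>\<^bsub>V\<^esub> v) = v"
  shows "v = \<zero>\<^bsub>V\<^esub>"
proof (rule ccontr)
  assume "v \<noteq> \<zero>\<^bsub>V\<^esub>"
  then obtain N where N: "stable H N" "v \<notin> N"
    and max: "\<And>N'. stable H N' \<Longrightarrow> N \<subseteq> N' \<Longrightarrow> N' \<noteq> N \<Longrightarrow> v \<in> N'"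
    using maximal_stable_avoiding[OF subgroup.subset[OF H]] by blast
  interpret N: additive_subgroup N V
    using N(1) by (simp add: stable_def)
  interpret act: additive_action "G\<lparr>carrier := Q\<rparr>" V translate
    using Q(1) by (rule additive_action_translate)
  let ?F = "{m \<in> carrier V. \<forall>q\<in>Q. translate q m \<ominus>\<^bsub>V\<^esub> m \<in> N}"
  have tr: "translate q m \<in> N" if "q \<in> Q" "m \<in> N" for q m
    using N(1) Q(2) that by (auto simp: stable_def basis_eq_monomial)
  obtain u where u: "u \<in> carrier V" "u \<notin> N" "\<And>q. q \<in> Q \<Longrightarrow> translate q u \<ominus>\<^bsub>V\<^esub> u \<in> N"
    using act.p_group_fixes_vector_mod[OF N.additive_subgroup_axioms _ p(1) _ _ v(1) N(2), of n]
      tr Q(3) add_pow_characteristic[OF _ p(2)] by (auto simp: order_def)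
  have "N \<subseteq> ?F"
    using tr N.a_subset act.N_diff[OF N.additive_subgroup_axioms] by auto
  moreover have "u \<in> ?F"
    using u by blast
  ultimately have "v \<in> ?F"
    using max[OF stable_fixed_mod[OF H Q(1) normal N(1)]] u(2) by blast
  then have "translate x v \<ominus>\<^bsub>V\<^esub> v \<in> N"
    using x by blast
  then have "a \<odot>\<^bsub>V\<^esub> (translate x v \<ominus>\<^bsub>V\<^esub> v) \<in> N"
    using stable_smult[OF N(1) subgroup.subset[OF H]] a by blast
  then show False
    using v(2) N(2) by simp
qed

end

section \<open>Normal p-subgroups act trivially\<close>

lemma ring_characteristic_annihilates_one:
  assumes "ring_characteristic R = p" "p \<noteq> 0"
  shows "add_pow R p \<one>\<^bsub>R\<^esub> = \<zero>\<^bsub>R\<^esub>"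
proof -
  let ?P = "\<lambda>n::nat. n > 0 \<and> [n] \<cdot>\<^bsub>R\<^esub> \<one>\<^bsub>R\<^esub> = \<zero>\<^bsub>R\<^esub>"
  have ex: "\<exists>n. ?P n" and "p = (LEAST n. ?P n)"
    using assms unfolding ring_characteristic_def by (auto split: if_splits)
  then show ?thesis
    using LeastI_ex[OF ex] by simp
qed

theorem theorem1p4:
  fixes k :: "('k, 'n) ring_scheme"
    and G :: "('g, 'm) monoid_scheme"
    and P :: "'g set"
    and p :: nat
    and V :: "('g \<Rightarrow> 'k, 'v, 'l) module_scheme"
  assumes "field k" and "Factorial_Ring.prime p" and "ring_characteristic k = p"
    and "locally_finite G"
    and "P \<lhd> G" and "p_subgroup p P G"
    and "irreducible_module (group_algebra k G) V"
  shows "acts_trivially k P V"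
  unfolding acts_trivially_def
proof (intro ballI)
  fix x v assume x: "x \<in> P" and v: "v \<in> carrier V"
  interpret k: field k by fact
  interpret P: normal P G by fact
  interpret V: irreducible_module "group_algebra k G" V by fact
  interpret group_algebra_module k G V ..
  have xG: "x \<in> carrier G"
    using x by (rule P.mem_carrier)
  then have xv: "translate x v \<in> carrier V"
    using v by (simp add: V.smult_closed basis_closed)
  show "translate x v = v"
  proof (rule ccontr)
    assume "translate x v \<noteq> v"
    then have "translate x v \<ominus>\<^bsub>V\<^esub> v \<noteq> \<zero>\<^bsub>V\<^esub>"
      using xv v by (metis V.M.diff_cancel V.M.l_zero)
    then obtain a where a: "a \<in> carrier (group_algebra k G)" "v = a \<odot>\<^bsub>V\<^esub> (translate x v \<ominus>\<^bsub>V\<^esub> v)"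
      using V.generated_by_nonzero[OF _ _ v] xv v by (metis V.M.minus_closed)
    \<comment> \<open>Only finitely many group elements occur in the equation for \<open>v\<close>, so it lives over a finite group.\<close>
    let ?S = "insert x (coeff_support k G a)"
    define H where "H = generate G ?S"
    have S: "finite ?S" "?S \<subseteq> carrier G"
      using a(1) xG by (auto simp: group_algebra_def coeff_support_def)
    have H: "subgroup H G"
      unfolding H_def using S(2) by (rule P.generate_is_subgroup)
    have finH: "finite H"
      using \<open>locally_finite G\<close> S unfolding locally_finite_def H_def by blast
    have SH: "?S \<subseteq> H"
      unfolding H_def by (auto intro: generate.incl)
    let ?Q = "P \<inter> H"
    have Q: "subgroup ?Q G"
      using P.subgroup_axioms H by (rule P.subgroups_Inter_pair)
    interpret Q: group "G\<lparr>carrier := ?Q\<rparr>"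
      using Q by (rule P.subgroup_imp_group)
    have p_el: "\<exists>n. y [^]\<^bsub>G\<lparr>carrier := ?Q\<rparr>\<^esub> (p ^ n) = \<one>\<^bsub>G\<lparr>carrier := ?Q\<rparr>\<^esub>"
      if "y \<in> carrier (G\<lparr>carrier := ?Q\<rparr>)" for y
    proof -
      have "y \<in> P"
        using that by simp
      then obtain n where "P.ord y = p ^ n"
        using \<open>p_subgroup p P G\<close> by (auto simp: p_subgroup_def)
      then have "y [^]\<^bsub>G\<^esub> (p ^ n) = \<one>\<^bsub>G\<^esub>"
        using P.pow_ord_eq_1[of y] P.mem_carrier[OF \<open>y \<in> P\<close>] by simp
      then show ?thesis
        by (auto simp: P.nat_pow_consistent[symmetric])
    qed
    have "finite (carrier (G\<lparr>carrier := ?Q\<rparr>))"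
      using finH by simp
    then obtain n where n: "card ?Q = p ^ n"
      using Q.order_eq_prime_power[OF _ \<open>Factorial_Ring.prime p\<close> p_el] by (auto simp: order_def)
    have char: "add_pow k p \<one>\<^bsub>k\<^esub> = \<zero>\<^bsub>k\<^esub>"
      using ring_characteristic_annihilates_one[OF \<open>ring_characteristic k = p\<close>]
        \<open>Factorial_Ring.prime p\<close> by auto
    have normal: "inv\<^bsub>G\<^esub> h \<otimes>\<^bsub>G\<^esub> q \<otimes>\<^bsub>G\<^esub> h \<in> ?Q" if "h \<in> H" "q \<in> ?Q" for h q
    proof
      show "inv\<^bsub>G\<^esub> h \<otimes>\<^bsub>G\<^esub> q \<otimes>\<^bsub>G\<^esub> h \<in> P"
        using that subgroup.subset[OF H] by (blast intro: P.inv_op_closed1)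
      show "inv\<^bsub>G\<^esub> h \<otimes>\<^bsub>G\<^esub> q \<otimes>\<^bsub>G\<^esub> h \<in> H"
        using that H by (simp add: subgroup.m_closed subgroup.m_inv_closed)
    qed
    have "v = \<zero>\<^bsub>V\<^esub>"
      by (rule augmentation_nakayama[OF \<open>Factorial_Ring.prime p\<close> char H Q _ n normal a(1)])
        (use SH x v a(2) in auto)
    \<comment> \<open>The zero vector is fixed by \<open>x\<close>, whereas \<open>v\<close> was chosen not to be.\<close>
    then have "translate x v = v"
      using xG by (simp add: V.smult_zero basis_closed)
    then show False
      using \<open>translate x v \<noteq> v\<close> by simp
  qed
qed

end
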